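(* Let $n,k$ be integers with $2\le k\le n-1$, let $\Omega^{n-k}$ be a domain in $\mathbb{R}^{n-k}$, and write $x''$ for a point of $\Omega^{n-k}$. Let $f_k:[0,M_k]\to[0,1]$ be the codimension $k$ Archimedean scaling function, and let $S^{k-1}(1)$ denote the unit sphere in $\mathbb{R}^k$. (a) Suppose $f$ is a nonnegative, continuously differentiable function on $\Omega^{n-k}$ such that the spherical array $H=\Omega^{n-k}\times_f S^{k-1}\subset\mathbb{R}^{n-k}\times\mathbb{R}^k$ satisfies the Archimedean projection property corresponding to orthogonal projection onto its base $\Omega^{n-k}$ with constant of proportionality $C=\mathrm{Vol}(S^{k-1}(1))$. Then $f(x'')\le 1$ for all $x''\in\Omega^{n-k}$, and on $A=\{x''\in\Omega^{n-k}: 0<f(x'')<1\}$ one has $f=f_k\circ\omega$, where $\omega$ is a positive, continuously differentiable solution of the eikonal equation $\|\nabla\omega(x'')\|=1$ on $A$. (b) Conversely, suppose that $\omega$ is a positive, continuously differentiable solution of the eikonal equation $\|\nabla\omega(x'')\|=1$ on $\Omega^{n-k}$ such that $\omega(x'')\le M_k$ for all $x''\in\Omega^{n-k}$. Then for $B=\{x''\in\Omega^{n-k}: 0<\omega(x'')\le M_k\}$, $f=f_k\circ\omega$ is a continuously differentiable function such that the spherical array $B\times_f S^{k-1}\subset\mathbb{R}^{n-k}\times\mathbb{R}^k$ satisfies the Archimedean projection property corresponding to orthogonal projection onto its base $B$ with constant of proportionality $C=\mathrm{Vol}(S^{k-1}(1))$.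
   Context: Spherical array: for $\Omega^{n-k}\subset\mathbb{R}^{n-k}$ (the base) and $f:\Omega^{n-k}\to[0,\infty)$ (the warping function), the spherical array $H=\Omega^{n-k}\times_f S^{k-1}$ is the hypersurface $$H=\{(x'',x')\in\Omega^{n-k}\times\mathbb{R}^k:\ \|x'\|^2=[f(x'')]^2\}\subset\mathbb{R}^{n-k}\times\mathbb{R}^k=\mathbb{R}^n .$$ Archimedean projection property (APP): let $H$ be a hypersurface in $\mathbb{R}^n=\mathbb{R}^{n-k}\times\mathbb{R}^k$ and let $\pi_{n-k}$ be the (codimension $k$) orthogonal projection of $\mathbb{R}^n$ onto $\mathbb{R}^{n-k}$ restricted to $H$. $H$ satisfies the APP corresponding to $\pi_{n-k}$ with constant of proportionality $C\neq 0$ if $\mathrm{Vol}(\pi_{n-k}^{-1}(U))=C\cdot\mathrm{Vol}(U)$ for every measurable $U\subset\pi_{n-k}(H)$; here the volume on the left is $(n-1)$-dimensional volume and the one on the right is $(n-k)$-dimensional volume. $\mathrm{Vol}(S^{k-1}(1))$ is the $(k-1)$-dimensional volume of the unit sphere. Archimedean scaling function: $M_k=\int_0^1\frac{t^{k-1}}{\sqrt{1-t^{2k-2}}}\,dt$, and $f_k:[0,M_k]\to[0,1]$ is the function whose inverse is $f_k^{-1}(y)=\int_0^y\frac{t^{k-1}}{\sqrt{1-t^{2k-2}}}\,dt$ for $0\le y\le 1$. *)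

theory Defs
  imports "HOL-Analysis.Analysis"
begin

text \<open>Hausdorff outer measure, without normalising constant. The empty set is given weight
  0 separately because diameter 0 to the power 0 would count it in dimension 0; boundedness is
  required because the diameter of an unbounded set is not meaningful in the library.\<close>

definition hausdorff_pre :: "nat \<Rightarrow> real \<Rightarrow> 'a::metric_space set \<Rightarrow> ennreal" where
  "hausdorff_pre d \<delta> E =
    (INF A \<in> {A :: nat \<Rightarrow> 'a set. E \<subseteq> (\<Union>i. A i) \<and> (\<forall>i. bounded (A i) \<and> diameter (A i) \<le> \<delta>)}.
       \<Sum>i. if A i = {} then 0 else ennreal (diameter (A i) ^ d))"

definition hausdorff :: "nat \<Rightarrow> 'a::metric_space set \<Rightarrow> ennreal" where
  "hausdorff d E = (SUP \<delta> \<in> {0<..}. hausdorff_pre d \<delta> E)"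

definition unit_cube :: "'a::euclidean_space set \<Rightarrow> 'a set" where
  "unit_cube B = {x. (\<forall>b\<in>B. 0 \<le> x \<bullet> b \<and> x \<bullet> b \<le> 1) \<and> (\<forall>b\<in>Basis - B. x \<bullet> b = 0)}"

text \<open>The d-dimensional volume of a subset of a Euclidean space of dimension at least d. It is
  Hausdorff measure scaled so that a d-dimensional unit cube has volume 1 (which coordinate
  face is taken is immaterial, they are isometric). Hausdorff measure on a d-plane is translation
  invariant, so with this scaling it is d-dimensional Lebesgue measure there, and on
  d-dimensional C1 submanifolds it is the usual surface volume. Dividing by the
  measure of the cube is multiplying by unit_ball_vol d / 2 ^ d, the customary constant.\<close>

definition vol :: "nat \<Rightarrow> 'a::euclidean_space set \<Rightarrow> ennreal" where
  "vol d E = hausdorff d E / hausdorff d (unit_cube (SOME B :: 'a set. B \<subseteq> Basis \<and> card B = d))"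

definition spherical_array ::
    "'a::euclidean_space set \<Rightarrow> ('a \<Rightarrow> real) \<Rightarrow> ('a \<times> 'b::euclidean_space) set" where
  "spherical_array \<Omega> f = {(x'', x'). x'' \<in> \<Omega> \<and> (norm x')\<^sup>2 = (f x'')\<^sup>2}"

text \<open>Here n - 1 is DIM('a \<times> 'b) - 1, and the projection is fst restricted to H. Volumes may be
  infinite; C itself is a nonzero real constant, and volumes being nonnegative, 0 < C.\<close>

definition archimedean_projection ::
    "ennreal \<Rightarrow> ('a::euclidean_space \<times> 'b::euclidean_space) set \<Rightarrow> bool" where
  "archimedean_projection C H \<longleftrightarrow> 0 < C \<and> C < \<infinity> \<and>
    (\<forall>U \<in> sets lebesgue. U \<subseteq> fst ` H \<longrightarrow>
       vol (DIM('a \<times> 'b) - 1) (H \<inter> fst -` U) = C * emeasure lebesgue U)"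

text \<open>For y = 1 the integrand is unbounded near the upper limit, but the integral converges
  absolutely; the value that division by zero gives at the point 1 itself is irrelevant.\<close>

definition arch_scale_inv :: "nat \<Rightarrow> real \<Rightarrow> real" where
  "arch_scale_inv k y = integral {0..y} (\<lambda>t. t ^ (k - 1) / sqrt (1 - t ^ (2 * k - 2)))"

definition arch_M :: "nat \<Rightarrow> real" where
  "arch_M k = integral {0..1} (\<lambda>t. t ^ (k - 1) / sqrt (1 - t ^ (2 * k - 2)))"

text \<open>Meaningful on the interval from 0 to arch_M k only.\<close>

definition arch_scale :: "nat \<Rightarrow> real \<Rightarrow> real" where
  "arch_scale k = the_inv_into {0..1} (arch_scale_inv k)"

text \<open>The next two notions are used on open sets.\<close>

definition C1_on :: "'a::real_inner set \<Rightarrow> ('a \<Rightarrow> real) \<Rightarrow> bool" where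
  "C1_on S f \<longleftrightarrow> (\<exists>g. continuous_on S g \<and> (\<forall>x\<in>S. GDERIV f x :> g x))"

definition eikonal_on :: "'a::real_inner set \<Rightarrow> ('a \<Rightarrow> real) \<Rightarrow> bool" where
  "eikonal_on S \<omega> \<longleftrightarrow> (\<forall>x\<in>S. \<exists>g. (GDERIV \<omega> x :> g) \<and> norm g = 1)"

end

theory Submission
  imports Defs
begin

text \<open>
  The whole statement reduces to one formula. Over a set \<open>U\<close> of the base on which \<open>f\<close> is positive,
  the spherical array has volume \<open>Vol(S)\<close> times the integral over \<open>U\<close> of the density
  \<open>J = f\<^sup>k\<^sup>-\<^sup>1 * sqrt (1 + |\<nabla>f|\<^sup>2)\<close>, so the projection property with constant \<open>Vol(S)\<close> says exactly
  that \<open>J = 1\<close>. For positive \<open>f\<close>, \<open>J = 1\<close> means \<open>f \<le> 1\<close> and \<open>|\<nabla>f| = sqrt (1 - f\<^sup>2\<^sup>k\<^sup>-\<^sup>2) / f\<^sup>k\<^sup>-\<^sup>1\<close>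
  (\<open>density_eq_1_iff\<close>). The right-hand side is the derivative of the scaling function \<open>f\<^sub>k\<close> at the
  point where its value is \<open>f\<close>, so the substitution \<open>f = f\<^sub>k \<circ> \<omega>\<close> turns this equation into the
  eikonal equation \<open>|\<nabla>\<omega>| = 1\<close>, in both directions (\<open>eikonal_of_density_1\<close>, \<open>density_1_of_eikonal\<close>).
  In the converse direction \<open>\<omega>\<close> cannot reach the value \<open>M\<^sub>k\<close>, the end of the domain of \<open>f\<^sub>k\<close>: that
  would be a maximum, where the gradient vanishes (\<open>eikonal_less_bound\<close>).

  The volume is a normalised Hausdorff measure, and the formula is needed only in a local form.
  The identity \<open>|a \<theta> - b \<theta>'|\<^sup>2 = (a - b)\<^sup>2 + a b |\<theta> - \<theta>'|\<^sup>2\<close> for unit vectors \<open>\<theta>, \<theta>'\<close>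
  (\<open>norm_diff_polar\<close>) shows that, over a small ball around \<open>x\<^sub>0\<close>, the array is almost isometric to a
  product \<open>T(E) \<times> S(f x\<^sub>0)\<close>, where \<open>T\<close> is a linear map with \<open>|T h|\<^sup>2 = |h|\<^sup>2 + (\<nabla>f(x\<^sub>0) \<bullet> h)\<^sup>2\<close>. Such
  a \<open>T\<close> is a rotation followed by a stretch along one axis, so it multiplies Lebesgue measure by
  \<open>sqrt (1 + |\<nabla>f(x\<^sub>0)|\<^sup>2)\<close>. Maps that distort distances by factors at most \<open>L\<close> distort \<open>d\<close>-dimensional
  volume by at most \<open>L\<^sup>d\<close>. Hence the array over \<open>E\<close> has volume \<open>J(x\<^sub>0) Vol(E) Vol(S)\<close> up to powers
  of \<open>L\<close> (\<open>vol_array_local\<close>). Small balls give \<open>J = 1\<close> from the projection property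
  (\<open>volume_density_eq_1\<close>); conversely a countable partition of the base into small pieces gives the
  property from \<open>J = 1\<close> (\<open>vol_array_of_density_1\<close>). In both cases \<open>L\<close> tends to 1 at the end.

  The volume of the product \<open>E \<times> S\<close> is found in the same way (\<open>vol_Times_sphere\<close>): small caps of the
  sphere are almost isometric to sets in a hyperplane, and for those the Hausdorff measure is
  Lebesgue measure (\<open>vol_eq_lborel\<close>), which is multiplicative on products. That last fact
  rests on three properties of Hausdorff measure: it is a measure on the Borel sets, it is
  translation invariant, and it is positive and finite on a cube.
\<close>

section \<open>Hausdorff measure as an outer measure\<close>

lemma hausdorff_pre_antimono: "\<delta> \<le> \<delta>' \<Longrightarrow> hausdorff_pre d \<delta>' E \<le> hausdorff_pre d \<delta> E"
  unfolding hausdorff_pre_def by (rule INF_superset_mono) (use order_trans in blast)+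

lemma hausdorff_pre_le_hausdorff: "0 < \<delta> \<Longrightarrow> hausdorff_pre d \<delta> E \<le> hausdorff d E"
  unfolding hausdorff_def by (rule SUP_upper) simp

lemma hausdorff_pre_le:
  assumes "E \<subseteq> (\<Union>i. A i)" "\<And>i. bounded (A i)" "\<And>i. diameter (A i) \<le> \<delta>"
  shows "hausdorff_pre d \<delta> E \<le> (\<Sum>i. if A i = {} then 0 else ennreal (diameter (A i) ^ d))"
  unfolding hausdorff_pre_def by (rule INF_lower) (use assms in auto)

lemma hausdorff_pre_lessD:
  assumes "hausdorff_pre d \<delta> E < c"
  shows "\<exists>A. E \<subseteq> (\<Union>i. A i) \<and> (\<forall>i. bounded (A i) \<and> diameter (A i) \<le> \<delta>) \<and>
    (\<Sum>i. if A i = {} then 0 else ennreal (diameter (A i) ^ d)) < c"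
  using assms unfolding hausdorff_pre_def INF_less_iff by (simp only: mem_Collect_eq bex_simps Bex_def conj_assoc)

lemma hausdorff_mono: "E \<subseteq> F \<Longrightarrow> hausdorff d E \<le> hausdorff d F"
  unfolding hausdorff_def hausdorff_pre_def
  by (intro SUP_subset_mono INF_superset_mono) auto

lemma hausdorff_empty [simp]: "hausdorff d {} = 0"
proof -
  have "hausdorff_pre d \<delta> {} = 0" if "\<delta> > 0" for \<delta>
    using hausdorff_pre_le[of "{}" "\<lambda>_. {}" \<delta> d] that by simp
  then have "hausdorff d ({} :: 'a set) \<le> 0" unfolding hausdorff_def by (intro SUP_least) auto
  then show ?thesis by simp
qed

lemma hausdorff_pre_subadditive:
  "hausdorff_pre d \<delta> (\<Union>i::nat. E i) \<le> (\<Sum>i. hausdorff_pre d \<delta> (E i))"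
proof (rule ennreal_le_epsilon)
  fix e :: real assume e: "0 < e" and fin: "(\<Sum>i. hausdorff_pre d \<delta> (E i)) < top"
  let ?w = "\<lambda>A :: 'a set. if A = {} then 0 else ennreal (diameter A ^ d)"
  define near where "near n A \<longleftrightarrow> E n \<subseteq> (\<Union>i. A i) \<and> (\<forall>i. bounded (A i) \<and> diameter (A i) \<le> \<delta>) \<and>
      (\<Sum>i. ?w (A i)) < hausdorff_pre d \<delta> (E n) + e * (1/2)^Suc n" for n and A :: "nat \<Rightarrow> 'a set"
  have "\<exists>A. near n A" for n
  proof -
    have "hausdorff_pre d \<delta> (E n) < hausdorff_pre d \<delta> (E n) + e * (1/2)^Suc n"
      using fin e by (auto simp add: less_top dest!: ennreal_suminf_lessD)
    from hausdorff_pre_lessD[OF this] show ?thesis unfolding near_def .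
  qed
  then obtain B where "\<And>n. near n (B n)" by metis
  then have B: "\<And>n. E n \<subseteq> (\<Union>i. B n i)" "\<And>n i. bounded (B n i)" "\<And>n i. diameter (B n i) \<le> \<delta>"
    and Bs: "\<And>n. (\<Sum>i::nat. ?w (B n i)) \<le> hausdorff_pre d \<delta> (E n) + e * (1/2)^Suc n"
    by (auto simp only: near_def intro: less_imp_le)
  define C where "C i = B (fst (prod_decode i)) (snd (prod_decode i))" for i
  have "(\<Union>i. E i) \<subseteq> (\<Union>i. C i)"
    using B(1) by (auto simp add: C_def subset_eq) (metis fst_conv snd_conv prod_encode_inverse)
  then have "hausdorff_pre d \<delta> (\<Union>i. E i) \<le> (\<Sum>i. ?w (C i))"
    using B by (intro hausdorff_pre_le) (auto simp: C_def)
  also have "\<dots> = (\<Sum>i. case_prod (\<lambda>n j. ?w (B n j)) (prod_decode i))"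
    by (simp add: C_def case_prod_unfold cong: if_cong)
  also have "\<dots> = (\<Sum>n. \<Sum>i. ?w (B n i))"
    using suminf_ennreal_2dimen[of "\<lambda>n. \<Sum>i. ?w (B n i)" "case_prod (\<lambda>n j. ?w (B n j))"]
    by (simp add: comp_def)
  also have "\<dots> \<le> (\<Sum>n. hausdorff_pre d \<delta> (E n) + e * (1/2) ^ Suc n)"
    by (intro suminf_le allI Bs) auto
  also have "... = (\<Sum>n. hausdorff_pre d \<delta> (E n)) + (\<Sum>n. ennreal e * ennreal ((1/2) ^ Suc n))"
    using \<open>0 < e\<close> by (subst suminf_add[symmetric])
                     (auto simp del: ennreal_suminf_cmult simp add: ennreal_mult[symmetric])
  also have "\<dots> = (\<Sum>n. hausdorff_pre d \<delta> (E n)) + e"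
    unfolding ennreal_suminf_cmult
    by (subst suminf_ennreal_eq[OF zero_le_power power_half_series]) auto
  finally show "hausdorff_pre d \<delta> (\<Union>i. E i) \<le> (\<Sum>n. hausdorff_pre d \<delta> (E n)) + e" .
qed

lemma hausdorff_subadditive: "hausdorff d (\<Union>i::nat. E i) \<le> (\<Sum>i. hausdorff d (E i))"
  unfolding hausdorff_def[of d "\<Union>i. E i"]
proof (rule SUP_least)
  fix \<delta> :: real assume "\<delta> \<in> {0<..}"
  then have "(\<Sum>i. hausdorff_pre d \<delta> (E i)) \<le> (\<Sum>i. hausdorff d (E i))"
    by (intro suminf_le hausdorff_pre_le_hausdorff) auto
  with hausdorff_pre_subadditive[of d \<delta> E]
  show "hausdorff_pre d \<delta> (\<Union>i. E i) \<le> (\<Sum>i. hausdorff d (E i))" by (rule order_trans)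
qed

lemma outer_measure_space_hausdorff: "outer_measure_space UNIV (hausdorff d)"
  unfolding outer_measure_space_def positive_def increasing_def countably_subadditive_def
  by (simp add: hausdorff_mono hausdorff_subadditive)

lemma hausdorff_Un_le: "hausdorff d (A \<union> B) \<le> hausdorff d A + hausdorff d B"
  using hausdorff_subadditive[of d "binaryset A B"]
  by (simp add: UN_binaryset_eq suminf_binaryset_eq[where f = "hausdorff d"])

lemma hausdorff_finite_UN_le:
  "finite I \<Longrightarrow> hausdorff d (\<Union>i\<in>I. A i) \<le> (\<Sum>i\<in>I. hausdorff d (A i))"
proof (induction I rule: finite_induct)
  case (insert i I)
  then show ?case
    using hausdorff_Un_le[of d "A i" "\<Union>i\<in>I. A i"] by (auto intro: order_trans add_left_mono)
qed simp

text \<open>The image of a cover of \<open>E\<close> covers the image of \<open>E\<close>, and its pieces have diameters at most \<open>L\<close> times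
as large. The power of \<open>L\<close> stands on the left so that the infimum over covers need not be
multiplied by a constant.\<close>

lemma hausdorff_pre_lipschitz:
  fixes f :: "'a::metric_space \<Rightarrow> 'b::real_normed_vector"
  assumes lip: "\<And>x y. x \<in> E \<Longrightarrow> y \<in> E \<Longrightarrow> dist (f x) (f y) \<le> L * dist x y" and L: "0 < L"
  shows "ennreal ((1 / L) ^ d) * hausdorff_pre d (L * \<delta>) (f ` E) \<le> hausdorff_pre d \<delta> E"
  unfolding hausdorff_pre_def[of d \<delta>]
proof (rule INF_greatest, clarify)
  fix A :: "nat \<Rightarrow> 'a set"
  assume E: "E \<subseteq> (\<Union>i. A i)" and A: "\<forall>i. bounded (A i) \<and> diameter (A i) \<le> \<delta>"
  let ?B = "\<lambda>i. f ` (E \<inter> A i)"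
  have near: "norm (u - v) \<le> L * diameter (A i)" if "u \<in> ?B i" "v \<in> ?B i" for u v i
  proof -
    from that obtain x y where xy: "x \<in> E" "x \<in> A i" "y \<in> E" "y \<in> A i" "u = f x" "v = f y" by auto
    then have "dist x y \<le> diameter (A i)" using A by (intro diameter_bounded_bound) auto
    then have "L * dist x y \<le> L * diameter (A i)" using L by simp
    with lip[OF xy(1,3)] xy show ?thesis by (simp add: dist_norm)
  qed
  have diam0: "0 \<le> diameter (A i)" for i using A by (intro diameter_ge_0) auto
  have dB: "diameter (?B i) \<le> L * diameter (A i)" for i
    using near L diam0[of i] by (intro diameter_le) auto
  have bB: "bounded (?B i)" for i
    using near unfolding bounded_def dist_norm by (metis all_not_in_conv)
  have "hausdorff_pre d (L * \<delta>) (f ` E) \<le>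
      (\<Sum>i. if ?B i = {} then 0 else ennreal (diameter (?B i) ^ d))"
  proof (rule hausdorff_pre_le)
    show "diameter (?B i) \<le> L * \<delta>" for i
      using A L dB[of i] by (meson mult_le_cancel_left_pos order_trans)
    show "f ` E \<subseteq> (\<Union>i. ?B i)" using E by blast
  qed (rule bB)
  also have "\<dots> \<le> (\<Sum>i. ennreal (L ^ d) * (if A i = {} then 0 else ennreal (diameter (A i) ^ d)))"
  proof (intro suminf_le allI)
    fix i
    show "(if ?B i = {} then 0 else ennreal (diameter (?B i) ^ d))
      \<le> ennreal (L ^ d) * (if A i = {} then 0 else ennreal (diameter (A i) ^ d))"
      using power_mono[OF dB, of i d] diameter_ge_0[OF bB, of i] L diam0[of i]
      by (auto simp: power_mult_distrib simp flip: ennreal_mult intro!: ennreal_leI)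
  qed auto
  also have "\<dots> = ennreal (L ^ d) * (\<Sum>i. if A i = {} then 0 else ennreal (diameter (A i) ^ d))"
    by (rule ennreal_suminf_cmult)
  finally have "ennreal ((1 / L) ^ d) * hausdorff_pre d (L * \<delta>) (f ` E) \<le> ennreal ((1 / L) ^ d) *
      (ennreal (L ^ d) * (\<Sum>i. if A i = {} then 0 else ennreal (diameter (A i) ^ d)))"
    by (rule mult_left_mono) simp
  also have "\<dots> = (\<Sum>i. if A i = {} then 0 else ennreal (diameter (A i) ^ d))"
    using L by (simp flip: mult.assoc ennreal_mult power_mult_distrib)
  finally show "ennreal ((1 / L) ^ d) * hausdorff_pre d (L * \<delta>) (f ` E) \<le>
      (\<Sum>i. if A i = {} then 0 else ennreal (diameter (A i) ^ d))" .
qed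

lemma hausdorff_lipschitz:
  fixes f :: "'a::metric_space \<Rightarrow> 'b::real_normed_vector"
  assumes lip: "\<And>x y. x \<in> E \<Longrightarrow> y \<in> E \<Longrightarrow> dist (f x) (f y) \<le> L * dist x y" and L: "0 < L"
  shows "hausdorff d (f ` E) \<le> ennreal (L ^ d) * hausdorff d E"
  unfolding hausdorff_def[of d "f ` E"]
proof (rule SUP_least)
  fix \<delta> :: real assume "\<delta> \<in> {0<..}"
  then have "ennreal ((1 / L) ^ d) * hausdorff_pre d \<delta> (f ` E) \<le> hausdorff d E"
    using hausdorff_pre_lipschitz[of E f L d "\<delta> / L"] lip L
      hausdorff_pre_le_hausdorff[of "\<delta> / L" d E] by auto
  then have "ennreal (L ^ d) * (ennreal ((1 / L) ^ d) * hausdorff_pre d \<delta> (f ` E))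
      \<le> ennreal (L ^ d) * hausdorff d E"
    by (rule mult_left_mono) simp
  moreover have "ennreal (L ^ d) * ennreal ((1 / L) ^ d) = 1"
    using L by (simp flip: ennreal_mult power_mult_distrib)
  ultimately show "hausdorff_pre d \<delta> (f ` E) \<le> ennreal (L ^ d) * hausdorff d E"
    by (simp flip: mult.assoc)
qed

section \<open>Borel sets are Hausdorff measurable\<close>

text \<open>A set of diameter less than \<open>\<eta>\<close> cannot meet both \<open>A\<close> and \<open>B\<close>, so a fine cover of the union splits
into a cover of \<open>A\<close> and a cover of \<open>B\<close>.\<close>

lemma hausdorff_separated:
  assumes sep: "\<And>x y. x \<in> A \<Longrightarrow> y \<in> B \<Longrightarrow> \<eta> \<le> dist x y" and \<eta>: "0 < \<eta>"
  shows "hausdorff d A + hausdorff d B \<le> hausdorff d (A \<union> B)"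
proof -
  let ?w = "\<lambda>A :: 'a set. if A = {} then 0 else ennreal (diameter A ^ d)"
  have split: "hausdorff_pre d \<delta> A + hausdorff_pre d \<delta> B \<le> hausdorff_pre d \<delta> (A \<union> B)"
    if \<delta>: "0 < \<delta>" "\<delta> < \<eta>" for \<delta>
    unfolding hausdorff_pre_def[of d \<delta> "A \<union> B"]
  proof (rule INF_greatest, clarify)
    fix C :: "nat \<Rightarrow> 'a set"
    assume AB: "A \<union> B \<subseteq> (\<Union>i. C i)" and C: "\<forall>i. bounded (C i) \<and> diameter (C i) \<le> \<delta>"
    define D where "D i = (if C i \<inter> A = {} then {} else C i)" for i
    define E where "E i = (if C i \<inter> B = {} then {} else C i)" for i
    have one: "C i \<inter> A = {} \<or> C i \<inter> B = {}" for i
    proof (rule ccontr)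
      assume "\<not> ?thesis"
      then obtain x y where "x \<in> C i" "x \<in> A" "y \<in> C i" "y \<in> B" by blast
      then show False
        using sep[of x y] C diameter_bounded_bound[of "C i" x y] \<delta> by (metis leD le_less_trans)
    qed
    have "hausdorff_pre d \<delta> A + hausdorff_pre d \<delta> B \<le> (\<Sum>i. ?w (D i)) + (\<Sum>i. ?w (E i))"
      using AB C \<delta> by (intro add_mono hausdorff_pre_le) (fastforce simp: D_def E_def)+
    also have "\<dots> = (\<Sum>i. ?w (D i) + ?w (E i))" by (rule suminf_add) auto
    also have "\<dots> \<le> (\<Sum>i. ?w (C i))"
      using one by (intro suminf_le allI) (auto simp: D_def E_def)
    finally show "hausdorff_pre d \<delta> A + hausdorff_pre d \<delta> B \<le> (\<Sum>i. ?w (C i))" .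
  qed
  have "hausdorff_pre d \<delta>1 A + hausdorff_pre d \<delta>2 B \<le> hausdorff d (A \<union> B)"
    if pos: "0 < \<delta>1" "0 < \<delta>2" for \<delta>1 \<delta>2
  proof -
    define \<delta> where "\<delta> = min (min \<delta>1 \<delta>2) (\<eta> / 2)"
    have \<delta>: "0 < \<delta>" "\<delta> < \<eta>" "\<delta> \<le> \<delta>1" "\<delta> \<le> \<delta>2" using pos \<eta> by (auto simp: \<delta>_def)
    have "hausdorff_pre d \<delta>1 A + hausdorff_pre d \<delta>2 B \<le> hausdorff_pre d \<delta> A + hausdorff_pre d \<delta> B"
      using \<delta> by (intro add_mono hausdorff_pre_antimono)
    with split[OF \<delta>(1,2)] hausdorff_pre_le_hausdorff[OF \<delta>(1), of d "A \<union> B"]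
    show ?thesis by (meson order_trans)
  qed
  then show ?thesis
    unfolding hausdorff_def[of d A] hausdorff_def[of d B]
    by (subst ennreal_SUP_add_left[symmetric], force, intro SUP_least,
        subst ennreal_SUP_add_right, force, intro SUP_least) auto
qed

lemma ennreal_suminf_tail:
  fixes a :: "nat \<Rightarrow> ennreal"
  assumes fin: "(\<Sum>i. a i) < top" and e: "0 < e"
  obtains n where "(\<Sum>i. a (i + n)) \<le> ennreal e"
proof -
  define r where "r i = enn2real (a i)" for i
  have a: "a i = ennreal (r i)" for i
    using ennreal_suminf_lessD[OF fin] by (simp add: r_def less_top)
  have r0: "0 \<le> r i" for i by (simp add: r_def)
  have sm: "summable r"
    using fin by (intro summable_suminf_not_top) (auto simp: a r0)
  then obtain n where n: "norm (\<Sum>i. r (i + n)) < e"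
    using suminf_exist_split[OF e sm] by blast
  have "(\<Sum>i. a (i + n)) = ennreal (\<Sum>i. r (i + n))"
    unfolding a using sm r0 by (intro suminf_ennreal2) (auto simp: summable_iff_shift)
  with n show thesis by (intro that[of n]) (auto intro!: ennreal_leI)
qed

text \<open>This is Caratheodory's criterion for metric outer measures. The part \<open>S n\<close> of \<open>T \<inter> U\<close> at distance at
least \<open>1 / (n + 1)\<close> from the complement of \<open>U\<close> is separated from \<open>T - U\<close>. What is missing from \<open>S n\<close>
is a tail of the sequence of layers \<open>R j\<close>. Layers whose indices differ by at least two are separated
from each other, so the even and the odd layers each have total measure at most that of \<open>T\<close>, and
the tails tend to 0.\<close>

lemma hausdorff_open_splits:
  fixes T U :: "'a::metric_space set"
  assumes U: "open U"
  shows "hausdorff d (T \<inter> U) + hausdorff d (T - U) = hausdorff d T"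
proof (rule antisym)
  show "hausdorff d T \<le> hausdorff d (T \<inter> U) + hausdorff d (T - U)"
    using hausdorff_Un_le[of d "T \<inter> U" "T - U"] by (simp add: Int_Diff_Un)
next
  show "hausdorff d (T \<inter> U) + hausdorff d (T - U) \<le> hausdorff d T"
  proof (cases "U = UNIV \<or> hausdorff d T = top")
    case True
    then show ?thesis by auto
  next
    case False
    then have C: "closed (- U)" "- U \<noteq> {}" and fin: "hausdorff d T < top"
      using U by (auto simp: less_top)
    define h where "h x = infdist x (- U)" for x
    have h_le: "h x \<le> h y + dist x y" for x y by (simp add: h_def infdist_triangle)
    have h0: "h x = 0" if "x \<notin> U" for x using that by (simp add: h_def)
    define S where "S n = {x \<in> T \<inter> U. 1 / Suc n \<le> h x}" for n
    define R where "R n = {x \<in> T \<inter> U. 1 / Suc (Suc n) \<le> h x \<and> h x < 1 / Suc n}" for n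
    have half: "(\<Sum>j<N. hausdorff d (R (2 * j + s))) \<le> hausdorff d T" for N s
    proof -
      have "(\<Sum>j<N. hausdorff d (R (2 * j + s))) \<le> hausdorff d (\<Union>j<N. R (2 * j + s))"
      proof (induction N)
        case (Suc N)
        have "hausdorff d (\<Union>j<N. R (2 * j + s)) + hausdorff d (R (2 * N + s)) \<le>
          hausdorff d ((\<Union>j<N. R (2 * j + s)) \<union> R (2 * N + s))" if "N \<noteq> 0"
        proof (rule hausdorff_separated)
          show "0 < 1 / real (2 * N + s) - 1 / real (Suc (2 * N + s))"
            using \<open>N \<noteq> 0\<close> by (simp add: divide_strict_left_mono)
        next
          fix x y assume "x \<in> (\<Union>j<N. R (2 * j + s))" and y: "y \<in> R (2 * N + s)"
          then obtain j where j: "j < N" "x \<in> R (2 * j + s)" by auto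
          have "1 / real (2 * N + s) \<le> 1 / real (Suc (Suc (2 * j + s)))"
            using j(1) by (intro divide_left_mono) auto
          then show "1 / real (2 * N + s) - 1 / real (Suc (2 * N + s)) \<le> dist x y"
            using j(2) y h_le[of x y] by (auto simp: R_def)
        qed
        then show ?case using Suc.IH
          by (cases "N = 0") (simp_all add: lessThan_Suc Un_commute add.commute, (meson add_left_mono order_trans)?)
      qed simp
      also have "\<dots> \<le> hausdorff d T" by (rule hausdorff_mono) (auto simp: R_def)
      finally show ?thesis .
    qed
    have sumR: "(\<Sum>j. hausdorff d (R j)) < top"
    proof -
      have "(\<Sum>j<N. hausdorff d (R j)) \<le> hausdorff d T + hausdorff d T" for N
      proof -
        have "(\<Sum>j<N. hausdorff d (R j)) \<le> (\<Sum>j<2*N. hausdorff d (R j))"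
          by (rule sum_mono2) auto
        also have "\<dots> = (\<Sum>j<N. hausdorff d (R (2 * j + 0))) + (\<Sum>j<N. hausdorff d (R (2 * j + 1)))"
          by (induction N) (auto simp: algebra_simps)
        also have "\<dots> \<le> hausdorff d T + hausdorff d T" by (intro add_mono half)
        finally show ?thesis .
      qed
      then have "(\<Sum>j. hausdorff d (R j)) \<le> hausdorff d T + hausdorff d T"
        by (intro suminf_le_const) auto
      then show ?thesis using fin by (auto simp: less_top intro: le_less_trans)
    qed
    show ?thesis
    proof (rule ennreal_le_epsilon)
      fix e :: real assume "0 < e"
      with sumR obtain n where n: "(\<Sum>i. hausdorff d (R (i + n))) \<le> ennreal e"
        by (rule ennreal_suminf_tail)
      have TU: "T \<inter> U \<subseteq> S n \<union> (\<Union>i. R (i + n))"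
      proof
        fix x assume x: "x \<in> T \<inter> U"
        then have hx: "0 < h x"
          using C unfolding h_def by (intro infdist_pos_not_in_closed) auto
        show "x \<in> S n \<union> (\<Union>i. R (i + n))"
        proof (cases "1 / Suc n \<le> h x")
          case False
          obtain k where k: "1 / real (Suc k) < h x"
            using hx by (metis nat_approx_posE)
          \<comment> \<open>The first threshold that \<open>h x\<close> reaches determines the layer of \<open>x\<close>.\<close>
          define m where "m = (LEAST m. 1 / real (Suc m) \<le> h x)"
          have m: "1 / real (Suc m) \<le> h x" unfolding m_def by (rule LeastI[of _ k]) (use k in simp)
          have m': "h x < 1 / real (Suc j)" if "j < m" for j
            using not_less_Least[of j "\<lambda>m. 1 / real (Suc m) \<le> h x"] that by (auto simp: m_def not_le)
          have "n < m"
          proof (rule ccontr)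
            assume "\<not> n < m"
            then have "1 / real (Suc n) \<le> 1 / real (Suc m)" by (intro divide_left_mono) auto
            with m False show False by simp
          qed
          then obtain i where "m = Suc (i + n)" by (metis add.commute less_imp_Suc_add)
          with m m'[of "i + n"] x show ?thesis by (auto simp: R_def)
        qed (use x in \<open>auto simp: S_def\<close>)
      qed
      have "hausdorff d (T \<inter> U) \<le> hausdorff d (S n) + hausdorff d (\<Union>i. R (i + n))"
        using hausdorff_mono[OF TU] hausdorff_Un_le by (rule order_trans)
      also have "\<dots> \<le> hausdorff d (S n) + e"
        using hausdorff_subadditive[of d "\<lambda>i. R (i + n)"] n by (intro add_left_mono) (rule order_trans)
      finally have "hausdorff d (T \<inter> U) + hausdorff d (T - U)
          \<le> (hausdorff d (S n) + hausdorff d (T - U)) + e"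
        by (metis (no_types, lifting) add.assoc add.commute add_right_mono)
      also have "hausdorff d (S n) + hausdorff d (T - U) \<le> hausdorff d (S n \<union> (T - U))"
      proof (rule hausdorff_separated)
        fix x y assume "x \<in> S n" "y \<in> T - U"
        then show "1 / real (Suc n) \<le> dist x y" using h_le[of x y] h0[of y] by (auto simp: S_def)
      qed simp
      also have "\<dots> \<le> hausdorff d T" by (rule hausdorff_mono) (auto simp: S_def)
      finally show "hausdorff d (T \<inter> U) + hausdorff d (T - U) \<le> hausdorff d T + e" by simp
    qed
  qed
qed

definition hausdorff_measure :: "nat \<Rightarrow> 'a::metric_space measure" where
  "hausdorff_measure d = measure_of UNIV (sets borel) (hausdorff d)"

lemma sets_hausdorff_measure [simp, measurable_cong]: "sets (hausdorff_measure d) = sets borel"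
  unfolding hausdorff_measure_def by (metis sets.sigma_sets_eq sets_measure_of space_borel subset_Pow_Union sets.space_closed)

lemma space_hausdorff_measure [simp]: "space (hausdorff_measure d) = UNIV"
  using sets_eq_imp_space_eq[OF sets_hausdorff_measure] by simp

text \<open>The lambda system of an outer measure is a sigma algebra on which it is a measure. It contains the
open sets, hence all Borel sets.\<close>

lemma emeasure_hausdorff_measure:
  assumes "A \<in> sets borel"
  shows "emeasure (hausdorff_measure d) A = hausdorff d A"
proof -
  interpret P: sigma_algebra UNIV "UNIV :: 'a set set" by (metis Pow_UNIV sigma_algebra_Pow)
  let ?L = "lambda_system UNIV UNIV (hausdorff d) :: 'a set set"
  have L: "measure_space UNIV ?L (hausdorff d)"
    by (rule P.caratheodory_lemma[OF outer_measure_space_hausdorff])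
  have "U \<in> ?L" if "open U" for U :: "'a set"
    using hausdorff_open_splits[OF that] by (auto simp: P.lambda_system_eq)
  then have sub: "sets borel \<subseteq> ?L"
    unfolding sets_borel using L
    by (intro sigma_algebra.sigma_sets_subset) (auto simp: measure_space_def)
  have "countably_additive (sets borel) (hausdorff d :: 'a set \<Rightarrow> _)"
    using L sub unfolding measure_space_def countably_additive_def by (meson order_trans subsetD)
  then show ?thesis
    unfolding hausdorff_measure_def using assms
    by (intro emeasure_measure_of_sigma) (auto simp: positive_def intro: sets.sigma_algebra_axioms[of borel, simplified])
qed

section \<open>Hausdorff measure in top dimension is Lebesgue measure\<close>

text \<open>Integrating \<open>1\<^sub>E(x) * 1\<^sub>F(y - x)\<close> in the two possible orders and using the invariance of both measures
gives \<open>M(E) * Leb(F) = M(-F) * Leb(E)\<close>. The cube as \<open>F\<close> shows that \<open>M\<close> is proportional to Lebesgue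
measure; the cube as both \<open>E\<close> and \<open>F\<close> identifies the constant.\<close>

lemma translation_invariant_measure_eq:
  fixes M :: "'a::euclidean_space measure"
  assumes sets [measurable_cong]: "sets M = sets borel" and "sigma_finite_measure M"
    and inv: "\<And>a A. A \<in> sets borel \<Longrightarrow> emeasure M ((\<lambda>x. x + a) -` A) = emeasure M A"
    and A [measurable]: "A \<in> sets borel"
  shows "emeasure M A = emeasure M (cbox 0 One) * emeasure lborel A"
proof -
  interpret M: sigma_finite_measure M by fact
  interpret P: pair_sigma_finite M lborel ..
  have space: "space M = UNIV" using sets_eq_imp_space_eq[OF sets] by simp
  have Minv: "distr M borel (\<lambda>x. x + y) = M" for y
  proof (rule measure_eqI)
    fix A :: "'a set" assume "A \<in> sets (distr M borel (\<lambda>x. x + y))"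
    then show "emeasure (distr M borel (\<lambda>x. x + y)) A = emeasure M A"
      using inv[of A y] by (subst emeasure_distr) (auto simp: space)
  qed (simp add: sets)
  have key: "emeasure M E * emeasure lborel F = emeasure M (uminus -` F) * emeasure lborel E"
    if [measurable]: "E \<in> sets borel" "F \<in> sets borel" for E F
  proof -
    have lF: "(\<integral>\<^sup>+y. indicator F (y - x) \<partial>lborel) = emeasure lborel F" for x
    proof -
      have "(\<integral>\<^sup>+y. indicator F (y - x) \<partial>lborel) = (\<integral>\<^sup>+y. indicator F (y - x) \<partial>distr lborel borel ((+) x))"
        by (simp add: lborel_distr_plus)
      also have "\<dots> = (\<integral>\<^sup>+y. indicator F y \<partial>lborel)"
        by (subst nn_integral_distr) auto
      finally show ?thesis by simp
    qed
    have lE: "(\<integral>\<^sup>+y. indicator E (x + y) \<partial>lborel) = emeasure lborel E" for x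
    proof -
      have "(\<integral>\<^sup>+y. indicator E (x + y) \<partial>lborel) = (\<integral>\<^sup>+y. indicator E y \<partial>distr lborel borel ((+) x))"
        by (subst nn_integral_distr) auto
      then show ?thesis by (simp add: lborel_distr_plus)
    qed
    have "emeasure M E * emeasure lborel F = (\<integral>\<^sup>+x. indicator E x * emeasure lborel F \<partial>M)"
      by (subst nn_integral_multc) auto
    also have "\<dots> = (\<integral>\<^sup>+x. \<integral>\<^sup>+y. indicator E x * indicator F (y - x) \<partial>lborel \<partial>M)"
      by (subst nn_integral_cmult) (auto simp: lF)
    also have "\<dots> = (\<integral>\<^sup>+y. \<integral>\<^sup>+x. indicator E x * indicator F (y - x) \<partial>M \<partial>lborel)"
      by (rule P.Fubini'[symmetric]) measurable
    also have "\<dots> = (\<integral>\<^sup>+y. \<integral>\<^sup>+x. indicator E (x + y) * indicator F (- x) \<partial>M \<partial>lborel)"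
    proof (rule nn_integral_cong)
      fix y
      have "(\<integral>\<^sup>+x. indicator E x * indicator F (y - x) \<partial>M)
          = (\<integral>\<^sup>+x. indicator E x * indicator F (y - x) \<partial>distr M borel (\<lambda>x. x + y))"
        by (simp add: Minv)
      also have "\<dots> = (\<integral>\<^sup>+x. indicator E (x + y) * indicator F (- x) \<partial>M)"
        by (subst nn_integral_distr) auto
      finally show "(\<integral>\<^sup>+x. indicator E x * indicator F (y - x) \<partial>M) =
          (\<integral>\<^sup>+x. indicator E (x + y) * indicator F (- x) \<partial>M)" .
    qed
    also have "\<dots> = (\<integral>\<^sup>+x. \<integral>\<^sup>+y. indicator E (x + y) * indicator F (- x) \<partial>lborel \<partial>M)"
      by (rule P.Fubini') measurable
    also have "\<dots> = (\<integral>\<^sup>+x. indicator (uminus -` F) x * emeasure lborel E \<partial>M)"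
    proof (rule nn_integral_cong)
      fix x
      have "(\<integral>\<^sup>+y. indicator E (x + y) * indicator F (- x) \<partial>lborel) = emeasure lborel E * indicator F (- x)"
        by (subst nn_integral_multc) (auto simp: lE)
      then show "(\<integral>\<^sup>+y. indicator E (x + y) * indicator F (- x) \<partial>lborel) =
          indicator (uminus -` F) x * emeasure lborel E"
        by (simp add: indicator_def mult.commute)
    qed
    also have "\<dots> = emeasure M (uminus -` F) * emeasure lborel E"
    proof (subst nn_integral_multc)
      have "uminus -` F \<in> sets borel" by (rule measurable_sets_borel[where M = borel]) auto
      then show "(\<integral>\<^sup>+x. indicator (uminus -` F) x \<partial>M) * emeasure lborel E = emeasure M (uminus -` F) * emeasure lborel E"
        by (subst nn_integral_indicator) (auto simp: sets)
      show "indicator (uminus -` F) \<in> borel_measurable M" 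
        using \<open>uminus -` F \<in> sets borel\<close> by (simp add: sets borel_measurable_indicator)
    qed
    finally show ?thesis .
  qed
  have "emeasure lborel (cbox 0 (One :: 'a)) = 1"
    by (subst emeasure_lborel_cbox) (auto simp: inner_Basis)
  then show ?thesis
    using key[of "cbox 0 One" "cbox 0 One"] key[OF A, of "cbox 0 One"] by simp
qed

text \<open>Dyadic subdivision covers the cube by arbitrarily small subcubes with disjoint interiors. A cube of
side \<open>s\<close> has diameter at most \<open>DIM('a) * s\<close>, so its weight is at most a constant times its volume, and
the volumes add up to at most 1.\<close>

lemma hausdorff_pre_cube_le:
  assumes "0 < \<delta>"
  shows "hausdorff_pre DIM('a) \<delta> (cbox 0 One :: 'a::euclidean_space set) \<le> ennreal (real DIM('a) ^ DIM('a))"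
proof -
  let ?w = "\<lambda>A :: 'a set. if A = {} then 0 else ennreal (diameter A ^ DIM('a))"
  have ne: "box 0 (One :: 'a) \<noteq> {}" by (simp add: box_ne_empty)
  obtain \<D> :: "'a set set" where D: "countable \<D>" "\<Union>\<D> \<subseteq> cbox 0 One"
    "\<And>K. K \<in> \<D> \<Longrightarrow> interior K \<noteq> {} \<and> (\<exists>c d. K = cbox c d)"
    "pairwise (\<lambda>A B. interior A \<inter> interior B = {}) \<D>"
    "\<And>K. K \<in> \<D> \<Longrightarrow> \<exists>x \<in> cbox 0 One \<inter> K. K \<subseteq> ball x (\<delta> / 2)"
    "\<And>u v. cbox u v \<in> \<D> \<Longrightarrow> \<exists>n. \<forall>i \<in> Basis. v \<bullet> i - u \<bullet> i = ((One :: 'a) \<bullet> i - 0 \<bullet> i) / 2^n"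
    "cbox 0 One \<subseteq> \<Union>\<D>"
    by (rule covering_lemma[of "cbox 0 One" "0 :: 'a" One "\<lambda>x. ball x (\<delta> / 2)"])
      (use ne assms in \<open>auto simp: gauge_ball_dependent\<close>)
  define A where "A i = (if i \<in> to_nat_on \<D> ` \<D> then from_nat_into \<D> i else {})" for i
  have A: "A i \<in> insert {} \<D>" for i
    using D(1) by (auto simp: A_def)
  have UA: "\<Union>\<D> = (\<Union>i. A i)"
    using D(1) A by (fastforce simp: A_def)
  have disj: "disjoint_family (\<lambda>i. interior (A i))"
    unfolding disjoint_family_on_def
  proof (intro ballI impI)
    fix i j :: nat assume "i \<noteq> j"
    show "interior (A i) \<inter> interior (A j) = {}"
    proof (cases "i \<in> to_nat_on \<D> ` \<D> \<and> j \<in> to_nat_on \<D> ` \<D>")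
      case True
      then have "A i \<in> \<D>" "A j \<in> \<D>" "A i \<noteq> A j"
        using \<open>i \<noteq> j\<close> D(1) by (auto simp: A_def)
      then show ?thesis using D(4) by (auto simp: pairwise_def)
    qed (auto simp: A_def)
  qed
  have bd: "bounded (A i) \<and> diameter (A i) \<le> \<delta>" for i
  proof (cases "A i = {}")
    case False
    then have "A i \<in> \<D>" using A[of i] by auto
    from D(5)[OF this] obtain x where x: "A i \<subseteq> ball x (\<delta> / 2)" by blast
    then have "bounded (A i)" using bounded_ball bounded_subset by blast
    moreover have "diameter (A i) \<le> \<delta>"
    proof (rule diameter_le)
      fix u v assume "u \<in> A i" "v \<in> A i"
      with x have "dist x u < \<delta> / 2" "dist x v < \<delta> / 2" by auto
      then show "norm (u - v) \<le> \<delta>" using dist_triangle2[of u v x] by (simp add: dist_norm norm_minus_commute)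
    qed (use assms in auto)
    ultimately show ?thesis by simp
  qed (use assms in auto)
  have "hausdorff_pre DIM('a) \<delta> (cbox 0 One :: 'a set) \<le> (\<Sum>i. ?w (A i))"
    using bd D(7) UA by (intro hausdorff_pre_le) auto
  also have "\<dots> \<le> (\<Sum>i. ennreal (real DIM('a) ^ DIM('a)) * emeasure lborel (interior (A i)))"
  proof (intro suminf_le allI)
    fix i
    show "?w (A i) \<le> ennreal (real DIM('a) ^ DIM('a)) * emeasure lborel (interior (A i))"
    proof (cases "A i = {}")
      case False
      then have AD: "A i \<in> \<D>" using A[of i] by auto
      then obtain u v where uv: "A i = cbox u v" using D(3) by blast
      with AD D(6) obtain n where n: "\<forall>i \<in> Basis. v \<bullet> i - u \<bullet> i = 1 / 2^n" by fastforce
      have le: "u \<bullet> i \<le> v \<bullet> i" if "i \<in> Basis" for i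
        using n that by (metis diff_ge_0_iff_ge zero_le_divide_1_iff zero_le_numeral zero_le_power)
      have "emeasure lborel (interior (A i)) = ennreal (\<Prod>i\<in>Basis. (v - u) \<bullet> i)"
        unfolding uv interior_cbox using le by (subst emeasure_lborel_box) auto
      also have "(\<Prod>i\<in>Basis. (v - u) \<bullet> i) = (1 / 2^n) ^ DIM('a)"
        using n by (simp add: inner_diff_left)
      finally have em: "emeasure lborel (interior (A i)) = ennreal ((1 / 2^n) ^ DIM('a))" .
      have "diameter (A i) \<le> real DIM('a) * (1 / 2^n)"
      proof (rule diameter_le)
        fix x y assume xy: "x \<in> A i" "y \<in> A i"
        have "norm (x - y) \<le> (\<Sum>b\<in>Basis. \<bar>(x - y) \<bullet> b\<bar>)" by (rule norm_le_l1)
        also have "\<dots> \<le> (\<Sum>b\<in>(Basis::'a set). 1 / 2^n)"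
        proof (rule sum_mono)
          fix b :: 'a assume b: "b \<in> Basis"
          with xy uv have "u \<bullet> b \<le> x \<bullet> b" "x \<bullet> b \<le> v \<bullet> b" "u \<bullet> b \<le> y \<bullet> b" "y \<bullet> b \<le> v \<bullet> b"
            by (auto simp: mem_box)
          with n b show "\<bar>(x - y) \<bullet> b\<bar> \<le> 1 / 2^n" by (auto simp: inner_diff_left)
        qed
        finally show "norm (x - y) \<le> real DIM('a) * (1 / 2^n)" by simp
      qed simp
      then have "diameter (A i) ^ DIM('a) \<le> (real DIM('a) * (1 / 2^n)) ^ DIM('a)"
        using bd by (intro power_mono diameter_ge_0) auto
      then show ?thesis
        unfolding em using False by (simp add: power_mult_distrib power_divide flip: ennreal_mult)
    qed simp
  qed auto
  also have "\<dots> = ennreal (real DIM('a) ^ DIM('a)) * (\<Sum>i. emeasure lborel (interior (A i)))"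
    by (rule ennreal_suminf_cmult)
  also have "(\<Sum>i. emeasure lborel (interior (A i))) = emeasure lborel (\<Union>i. interior (A i))"
    using disj by (intro suminf_emeasure) auto
  also have "\<dots> \<le> emeasure lborel (cbox 0 (One :: 'a))"
  proof (rule emeasure_mono)
    show "(\<Union>i. interior (A i)) \<subseteq> cbox 0 One" using D(2) UA interior_subset by blast
  qed simp
  also have "\<dots> = 1" by (subst emeasure_lborel_cbox) (auto simp: inner_Basis)
  finally show ?thesis by (simp add: mult_left_mono)
qed

lemma hausdorff_cube_finite: "hausdorff DIM('a) (cbox 0 One :: 'a::euclidean_space set) < top"
proof -
  have "hausdorff DIM('a) (cbox 0 One :: 'a set) \<le> ennreal (real DIM('a) ^ DIM('a))"
    unfolding hausdorff_def by (intro SUP_least hausdorff_pre_cube_le) auto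
  then show ?thesis by (metis ennreal_less_top order_le_less_trans)
qed

text \<open>A set of diameter \<open>r\<close> lies in a closed ball of radius \<open>r\<close> around any of its points. So the weights of
a cover of the cube bound its volume 1 up to the volume of the unit ball.\<close>

lemma hausdorff_cube_pos: "0 < hausdorff DIM('a) (cbox 0 One :: 'a::euclidean_space set)"
proof -
  let ?w = "\<lambda>A :: 'a set. if A = {} then 0 else ennreal (diameter A ^ DIM('a))"
  let ?V = "unit_ball_vol (real DIM('a))"
  have V: "?V > 0" by simp
  have "ennreal (1 / ?V) \<le> hausdorff_pre DIM('a) 1 (cbox 0 One :: 'a set)"
    unfolding hausdorff_pre_def
  proof (rule INF_greatest, clarify)
    fix A :: "nat \<Rightarrow> 'a set"
    assume cov: "cbox 0 One \<subseteq> (\<Union>i. A i)" and A: "\<forall>i. bounded (A i) \<and> diameter (A i) \<le> 1"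
    define B where "B i = (if A i = {} then {} else cball (SOME x. x \<in> A i) (diameter (A i)))" for i
    have AB: "A i \<subseteq> B i" for i
    proof
      fix x assume x: "x \<in> A i"
      then have "(SOME x. x \<in> A i) \<in> A i" by (rule someI)
      then have "dist (SOME x. x \<in> A i) x \<le> diameter (A i)"
        using x A by (intro diameter_bounded_bound) auto
      then show "x \<in> B i" using x by (auto simp: B_def)
    qed
    have "1 = emeasure lborel (cbox 0 (One :: 'a))"
      by (subst emeasure_lborel_cbox) (auto simp: inner_Basis)
    also have "\<dots> \<le> emeasure lborel (\<Union>i. B i)"
      proof (rule emeasure_mono)
      show "cbox 0 One \<subseteq> (\<Union>i. B i)" using cov AB by blast
    qed (auto simp: B_def)
    also have "\<dots> \<le> (\<Sum>i. emeasure lborel (B i))"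
      by (intro emeasure_subadditive_countably) (auto simp: B_def)
    also have "\<dots> = (\<Sum>i. ennreal ?V * ?w (A i))"
    proof (rule suminf_cong)
      show "emeasure lborel (B i) = ennreal ?V * ?w (A i)" for i
        using A by (auto simp: B_def emeasure_cball diameter_ge_0 simp flip: ennreal_mult)
    qed
    also have "\<dots> = ennreal ?V * (\<Sum>i. ?w (A i))" by (rule ennreal_suminf_cmult)
    finally have "ennreal (1 / ?V) * 1 \<le> ennreal (1 / ?V) * (ennreal ?V * (\<Sum>i. ?w (A i)))"
      by (rule mult_left_mono) simp
    then show "ennreal (1 / ?V) \<le> (\<Sum>i. ?w (A i))"
      using V by (simp flip: mult.assoc ennreal_mult)
  qed
  also have "\<dots> \<le> hausdorff DIM('a) (cbox 0 One :: 'a set)"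
    by (rule hausdorff_pre_le_hausdorff) simp
  finally show ?thesis using V by (metis divide_pos_pos ennreal_less_zero_iff less_le_trans zero_less_one)
qed

lemma hausdorff_isometric_image:
  fixes f :: "'a::real_normed_vector \<Rightarrow> 'b::real_normed_vector"
  assumes iso: "\<And>x y. x \<in> E \<Longrightarrow> y \<in> E \<Longrightarrow> dist (f x) (f y) = dist x y"
  shows "hausdorff d (f ` E) = hausdorff d E"
proof (rule antisym)
  show "hausdorff d (f ` E) \<le> hausdorff d E"
    using hausdorff_lipschitz[of E f 1 d] iso by simp
  have inj: "inj_on f E" by (rule inj_onI) (metis dist_eq_0_iff iso)
  have "hausdorff d (the_inv_into E f ` f ` E) \<le> ennreal (1 ^ d) * hausdorff d (f ` E)"
    by (rule hausdorff_lipschitz) (auto simp: the_inv_into_f_f[OF inj] iso)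
  then show "hausdorff d E \<le> hausdorff d (f ` E)"
    by (simp add: image_image the_inv_into_f_f[OF inj])
qed

lemma hausdorff_scale:
  fixes E :: "'a::real_normed_vector set"
  assumes r: "0 < r"
  shows "hausdorff d ((*\<^sub>R) r ` E) = ennreal (r ^ d) * hausdorff d E"
proof (rule antisym)
  show "hausdorff d ((*\<^sub>R) r ` E) \<le> ennreal (r ^ d) * hausdorff d E"
    using r by (intro hausdorff_lipschitz) (auto simp: dist_norm simp flip: scaleR_diff_right)
  have "hausdorff d ((*\<^sub>R) (1 / r) ` (*\<^sub>R) r ` E) \<le> ennreal ((1 / r) ^ d) * hausdorff d ((*\<^sub>R) r ` E)"
    using r by (intro hausdorff_lipschitz) (auto simp: dist_norm simp flip: scaleR_diff_right)
  then have "hausdorff d E \<le> ennreal ((1 / r) ^ d) * hausdorff d ((*\<^sub>R) r ` E)"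
    using r by (simp add: image_image)
  then have "ennreal (r ^ d) * hausdorff d E
      \<le> ennreal (r ^ d) * (ennreal ((1 / r) ^ d) * hausdorff d ((*\<^sub>R) r ` E))"
    by (rule mult_left_mono) simp
  also have "\<dots> = hausdorff d ((*\<^sub>R) r ` E)"
    using r by (simp flip: mult.assoc ennreal_mult power_mult_distrib)
  finally show "ennreal (r ^ d) * hausdorff d E \<le> hausdorff d ((*\<^sub>R) r ` E)" .
qed

lemma hausdorff_ball_finite: "hausdorff DIM('a) (ball (0::'a::euclidean_space) r) < top"
proof -
  define s where "s = max 1 (2 * r)"
  have s: "0 < s" "2 * r \<le> s" by (auto simp: s_def)
  let ?f = "\<lambda>x. x - (s / 2) *\<^sub>R One"
  have "ball (0::'a) r \<subseteq> ?f ` (*\<^sub>R) s ` cbox 0 One"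
  proof
    fix x :: 'a assume "x \<in> ball 0 r"
    then have "\<bar>x \<bullet> b\<bar> \<le> s / 2" if "b \<in> Basis" for b
      using Basis_le_norm[OF that, of x] s by simp
    then have "(1 / s) *\<^sub>R (x + (s / 2) *\<^sub>R One) \<in> cbox 0 One"
      using s(1) by (force simp: mem_box inner_add_left field_simps abs_le_iff)
    moreover have "x = ?f (s *\<^sub>R ((1 / s) *\<^sub>R (x + (s / 2) *\<^sub>R One)))"
      using s(1) by simp
    ultimately show "x \<in> ?f ` (*\<^sub>R) s ` cbox 0 One" by blast
  qed
  then have "hausdorff DIM('a) (ball (0::'a) r) \<le> hausdorff DIM('a) (?f ` (*\<^sub>R) s ` cbox 0 (One::'a))"
    by (rule hausdorff_mono)
  also have "\<dots> = ennreal (s ^ DIM('a)) * hausdorff DIM('a) (cbox 0 (One :: 'a))"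
    by (subst hausdorff_isometric_image) (auto simp: hausdorff_scale[OF s(1)] dist_norm)
  also have "\<dots> < top" using hausdorff_cube_finite[where 'a = 'a] by (simp add: ennreal_mult_less_top)
  finally show ?thesis .
qed

theorem hausdorff_eq_lborel:
  fixes A :: "'a::euclidean_space set"
  assumes A: "A \<in> sets borel"
  shows "hausdorff DIM('a) A = hausdorff DIM('a) (cbox 0 One :: 'a set) * emeasure lborel A"
proof -
  let ?M = "hausdorff_measure DIM('a) :: 'a measure"
  have "emeasure ?M A = emeasure ?M (cbox 0 One) * emeasure lborel A"
  proof (rule translation_invariant_measure_eq)
    show "sigma_finite_measure ?M"
    proof
      show "\<exists>A. countable A \<and> A \<subseteq> sets ?M \<and> \<Union>A = space ?M \<and> (\<forall>a\<in>A. emeasure ?M a \<noteq> \<infinity>)"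
      proof (intro exI conjI ballI)
        show "countable (range (\<lambda>n::nat. ball (0::'a) (real n)))" by simp
        show "\<Union> (range (\<lambda>n::nat. ball (0::'a) (real n))) = space ?M"
          by (auto simp: reals_Archimedean2)
        show "emeasure ?M a \<noteq> \<infinity>" if "a \<in> range (\<lambda>n::nat. ball (0::'a) (real n))" for a
          using that hausdorff_ball_finite[where 'a = 'a] by (auto simp: emeasure_hausdorff_measure less_top)
      qed auto
    qed
    fix a :: 'a and A :: "'a set" assume "A \<in> sets borel"
    moreover have "(\<lambda>x. x + a) -` A \<in> sets borel"
      using \<open>A \<in> sets borel\<close> by (rule measurable_sets_borel[rotated]) simp
    moreover have "(\<lambda>x. x + a) -` A = (\<lambda>x. x - a) ` A"
      by (auto simp: image_iff) (metis add_diff_cancel_right')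
    moreover have "hausdorff DIM('a) ((\<lambda>x. x - a) ` A) = hausdorff DIM('a) A"
      by (rule hausdorff_isometric_image) (simp add: dist_norm)
    ultimately show "emeasure ?M ((\<lambda>x. x + a) -` A) = emeasure ?M A"
      by (simp add: emeasure_hausdorff_measure)
  qed (use A in auto)
  then show ?thesis using A by (simp add: emeasure_hausdorff_measure)
qed

section \<open>Normalised volume\<close>

text \<open>Coordinate cubes of the same dimension are isometric, even in different spaces. Hence the
normalising constants of volumes in different ambient spaces agree, and Lipschitz maps between such
spaces can be used to compare volumes.\<close>

lemma hausdorff_unit_cube_cong:
  fixes A :: "'a::euclidean_space set" and B :: "'b::euclidean_space set"
  assumes A: "A \<subseteq> Basis" and B: "B \<subseteq> Basis" and card: "card A = card B"
  shows "hausdorff d (unit_cube A) = hausdorff d (unit_cube B)"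
proof -
  have fin: "finite A" "finite B" using A B finite_Basis finite_subset by blast+
  then obtain h where h: "bij_betw h A B"
    using finite_same_card_bij card by blast
  define g where "g x = (\<Sum>i\<in>A. (x \<bullet> i) *\<^sub>R h i)" for x :: 'a
  have hB: "h i \<in> B" "h i \<in> Basis" if "i \<in> A" for i using h B that by (auto simp: bij_betw_def)
  have gh: "g x \<bullet> h j = x \<bullet> j" if j: "j \<in> A" for x j
  proof -
    have "g x \<bullet> h j = (\<Sum>i\<in>A. if i = j then x \<bullet> i else 0)"
      unfolding g_def inner_sum_left
    proof (rule sum.cong)
      fix i assume i: "i \<in> A"
      then have "h i = h j \<longleftrightarrow> i = j" using h j by (auto simp: bij_betw_def inj_on_eq_iff)
      then show "((x \<bullet> i) *\<^sub>R h i) \<bullet> h j = (if i = j then x \<bullet> i else 0)"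
        using hB[OF i] hB[OF j] by (auto simp: inner_Basis)
    qed simp
    then show ?thesis using j fin by simp
  qed
  have gout: "g x \<bullet> b = 0" if "b \<in> Basis - B" for x b
    using that hB unfolding g_def inner_sum_left by (intro sum.neutral) (auto simp: inner_Basis)
  have gdiff: "g x - g y = g (x - y)" for x y
    by (simp add: g_def inner_diff_left scaleR_diff_left sum_subtractf)
  have gg: "g x \<bullet> g x = x \<bullet> x" if "\<forall>b\<in>Basis - A. x \<bullet> b = 0" for x
  proof -
    have "g x \<bullet> g x = (\<Sum>i\<in>A. (x \<bullet> i) * (g x \<bullet> h i))"
      by (subst (2) g_def) (simp add: inner_sum_right)
    also have "\<dots> = (\<Sum>i\<in>A. (x \<bullet> i) * (x \<bullet> i))" by (simp add: gh)
    also have "\<dots> = (\<Sum>i\<in>Basis. (x \<bullet> i) * (x \<bullet> i))"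
      using A that by (intro sum.mono_neutral_left) auto
    finally show ?thesis by (simp add: euclidean_inner[of x x])
  qed
  have iso: "dist (g x) (g y) = dist x y" if "x \<in> unit_cube A" "y \<in> unit_cube A" for x y
    using that gg[of "x - y"]
    by (simp add: dist_norm gdiff norm_eq_sqrt_inner unit_cube_def inner_diff_left)
  have "unit_cube B = g ` unit_cube A"
  proof (intro subset_antisym subsetI)
    fix y assume y: "y \<in> unit_cube B"
    define x where "x = (\<Sum>i\<in>A. (y \<bullet> h i) *\<^sub>R i)"
    have xi: "x \<bullet> i = (if i \<in> A then y \<bullet> h i else 0)" if i: "i \<in> Basis" for i
    proof -
      have "x \<bullet> i = (\<Sum>j\<in>A. if j = i then y \<bullet> h j else 0)"
        unfolding x_def inner_sum_left using A i by (intro sum.cong) (auto simp: inner_Basis)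
      then show ?thesis using fin by simp
    qed
    have "g x = y"
    proof (rule euclidean_eqI)
      fix b :: 'b assume b: "b \<in> Basis"
      show "g x \<bullet> b = y \<bullet> b"
      proof (cases "b \<in> B")
        case True
        then obtain i where "i \<in> A" "b = h i" using h by (auto simp: bij_betw_def)
        then show ?thesis using A by (auto simp: gh xi)
      next
        case False
        with b y show ?thesis by (simp add: gout unit_cube_def)
      qed
    qed
    moreover have "x \<in> unit_cube A"
      using y hB A by (auto simp: xi unit_cube_def)
    ultimately show "y \<in> g ` unit_cube A" by blast
  next
    fix y assume "y \<in> g ` unit_cube A"
    then obtain x where x: "x \<in> unit_cube A" "y = g x" by blast
    have "0 \<le> y \<bullet> b \<and> y \<bullet> b \<le> 1" if b: "b \<in> B" for b
    proof -
      obtain i where "i \<in> A" "b = h i" using b h unfolding bij_betw_def by blast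
      with x show ?thesis by (auto simp: gh unit_cube_def)
    qed
    then show "y \<in> unit_cube B" using gout x by (auto simp: unit_cube_def)
  qed
  then show ?thesis by (simp add: hausdorff_isometric_image iso)
qed

lemma vol_eq:
  fixes B :: "'b::euclidean_space set" and E :: "'a::euclidean_space set"
  assumes "B \<subseteq> Basis" "card B = d" "d \<le> DIM('a)"
  shows "vol d E = hausdorff d E / hausdorff d (unit_cube B)"
proof -
  obtain A :: "'a set" where "A \<subseteq> Basis \<and> card A = d"
    using obtain_subset_with_card_n[OF assms(3)] by metis
  from someI[of "\<lambda>A :: 'a set. A \<subseteq> Basis \<and> card A = d", OF this]
  show ?thesis unfolding vol_def using assms by (subst hausdorff_unit_cube_cong[where B = B]) auto
qed

lemma vol_mono: "E \<subseteq> F \<Longrightarrow> vol d E \<le> vol d F"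
  unfolding vol_def by (intro divide_right_mono_ennreal hausdorff_mono)

lemma vol_subadditive: "vol d (\<Union>i::nat. E i) \<le> (\<Sum>i. vol d (E i))"
  unfolding vol_def ennreal_suminf_divide by (intro divide_right_mono_ennreal hausdorff_subadditive)

lemma vol_finite_UN_le: "finite I \<Longrightarrow> vol d (\<Union>i\<in>I. A i) \<le> (\<Sum>i\<in>I. vol d (A i))"
  unfolding vol_def divide_ennreal_def sum_distrib_right[symmetric]
  by (intro mult_right_mono hausdorff_finite_UN_le) auto

lemma vol_suminf:
  fixes A :: "nat \<Rightarrow> 'a::euclidean_space set"
  assumes "disjoint_family A" "\<And>i. A i \<in> sets borel"
  shows "vol d (\<Union>i. A i) = (\<Sum>i. vol d (A i))"
proof -
  have "hausdorff d (\<Union>i. A i) = (\<Sum>i. hausdorff d (A i))"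
    using suminf_emeasure[of A "hausdorff_measure d"] assms
    by (simp add: emeasure_hausdorff_measure image_subset_iff)
  then show ?thesis by (simp add: vol_def)
qed

lemma vol_lipschitz:
  fixes f :: "'a::euclidean_space \<Rightarrow> 'b::euclidean_space"
  assumes "\<And>x y. x \<in> E \<Longrightarrow> y \<in> E \<Longrightarrow> dist (f x) (f y) \<le> L * dist x y" "0 < L"
    and "d \<le> DIM('a)" "d \<le> DIM('b)"
  shows "vol d (f ` E) \<le> ennreal (L ^ d) * vol d E"
proof -
  obtain B :: "'b set" where B: "B \<subseteq> Basis" "card B = d"
    using obtain_subset_with_card_n[OF assms(4)] by metis
  have "hausdorff d (f ` E) / hausdorff d (unit_cube B)
      \<le> ennreal (L ^ d) * hausdorff d E / hausdorff d (unit_cube B)"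
    using assms by (intro divide_right_mono_ennreal hausdorff_lipschitz)
  then show ?thesis using assms by (simp add: vol_eq[OF B] ennreal_times_divide)
qed

lemma vol_le_of_expanding:
  fixes f :: "'a::euclidean_space \<Rightarrow> 'b::euclidean_space"
  assumes exp: "\<And>x y. x \<in> E \<Longrightarrow> y \<in> E \<Longrightarrow> dist x y \<le> L * dist (f x) (f y)" and L: "0 < L"
    and d: "d \<le> DIM('a)" "d \<le> DIM('b)"
  shows "vol d E \<le> ennreal (L ^ d) * vol d (f ` E)"
proof -
  have inj: "inj_on f E"
  proof (rule inj_onI)
    fix x y assume "x \<in> E" "y \<in> E" "f x = f y"
    then show "x = y" using exp[of x y] by simp
  qed
  have "vol d (the_inv_into E f ` f ` E) \<le> ennreal (L ^ d) * vol d (f ` E)"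
    using L d by (intro vol_lipschitz) (auto simp: the_inv_into_f_f[OF inj] exp)
  then show ?thesis by (simp add: image_image the_inv_into_f_f[OF inj])
qed

lemma vol_isometric_image:
  fixes f :: "'a::euclidean_space \<Rightarrow> 'a"
  assumes "\<And>x y. x \<in> E \<Longrightarrow> y \<in> E \<Longrightarrow> dist (f x) (f y) = dist x y"
  shows "vol d (f ` E) = vol d E"
  unfolding vol_def using assms by (simp add: hausdorff_isometric_image)

lemma vol_scale:
  fixes E :: "'a::euclidean_space set"
  shows "0 < r \<Longrightarrow> vol d ((*\<^sub>R) r ` E) = ennreal (r ^ d) * vol d E"
  by (simp add: vol_def hausdorff_scale ennreal_times_divide)

theorem vol_eq_lborel:
  fixes A :: "'a::euclidean_space set"
  assumes "A \<in> sets borel"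
  shows "vol DIM('a) A = emeasure lborel A"
proof -
  have cube: "unit_cube Basis = cbox 0 (One :: 'a)" by (auto simp: unit_cube_def mem_box)
  have "vol DIM('a) A = hausdorff DIM('a) A / hausdorff DIM('a) (cbox 0 (One :: 'a))"
    using vol_eq[of "Basis :: 'a set" "DIM('a)" A] by (simp add: cube)
  also have "\<dots> = emeasure lborel A"
    unfolding hausdorff_eq_lborel[OF assms]
    using hausdorff_cube_pos[where 'a = 'a] hausdorff_cube_finite[where 'a = 'a]
    by (subst mult.commute) (auto intro: ennreal_mult_divide_eq)
  finally show ?thesis .
qed

section \<open>The product of a set and a sphere\<close>

lemma ennreal_le_of_le_power_mult:
  fixes x y :: ennreal
  assumes "\<And>L. 1 < L \<Longrightarrow> x \<le> ennreal (L ^ d) * y"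
  shows "x \<le> y"
proof (rule tendsto_lowerbound)
  have "((\<lambda>L::real. ennreal (L ^ d) * y) \<longlongrightarrow> ennreal (1 ^ d) * y) (at_right 1)"
    by (intro tendsto_mult_ennreal tendsto_intros) auto
  then show "((\<lambda>L::real. ennreal (L ^ d) * y) \<longlongrightarrow> y) (at_right 1)" by simp
  show "\<forall>\<^sub>F L in at_right (1::real). x \<le> ennreal (L ^ d) * y"
    using assms by (auto simp: eventually_at_right_field intro: exI[of _ 2])
qed simp

text \<open>The orthogonal projection \<open>p\<close> onto the tangent hyperplane at \<open>e\<close>, read in coordinates from the space
\<open>'j\<close>, never increases distances. For unit vectors \<open>\<theta>, \<theta>'\<close> the difference \<open>\<theta> - \<theta>'\<close> is orthogonal to
\<open>\<theta> + \<theta>'\<close>, so its component along \<open>e\<close> is its inner product with \<open>e - (\<theta> + \<theta>') / 2\<close>. Near \<open>e\<close> this is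
a small multiple of \<open>|\<theta> - \<theta>'|\<close>, so the projection loses little.\<close>

lemma sphere_cap_chart:
  fixes e :: "'b::euclidean_space"
  assumes dim: "DIM('j::euclidean_space) + 1 = DIM('b)" and e: "norm e = 1" and L: "1 < L"
  obtains p :: "'b \<Rightarrow> 'j::euclidean_space" and \<phi> and \<eta> where
    "continuous_on UNIV \<phi>" "\<And>q. p (\<phi> q) = q" "\<And>x y. dist (p x) (p y) \<le> dist x y"
    "ball 0 1 \<subseteq> p ` sphere 0 1" "0 < \<eta>"
    "\<And>\<theta>. \<theta> \<in> sphere 0 1 \<inter> ball e \<eta> \<Longrightarrow> \<phi> (p \<theta>) = \<theta>"
    "\<And>\<theta> \<theta>'. \<theta> \<in> sphere 0 1 \<inter> ball e \<eta> \<Longrightarrow> \<theta>' \<in> sphere 0 1 \<inter> ball e \<eta> \<Longrightarrow>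
       dist \<theta> \<theta>' \<le> L * dist (p \<theta>) (p \<theta>')"
proof -
  have ee: "e \<bullet> e = 1" using e by (simp add: dot_square_norm)
  have "e \<noteq> 0" using e by auto
  then have dims: "dim (UNIV :: 'j set) = dim {x. e \<bullet> x = 0}"
    using dim by (simp add: dim_hyperplane)
  obtain f :: "'j \<Rightarrow> 'b" and g where fg0: "linear f" "linear g" "f ` UNIV = {x. e \<bullet> x = 0}"
      "g ` {x. e \<bullet> x = 0} = UNIV"
      "\<And>x. x \<in> UNIV \<Longrightarrow> norm (f x) = norm x" "\<And>x. x \<in> {x. e \<bullet> x = 0} \<Longrightarrow> norm (g x) = norm x"
      "\<And>x. x \<in> UNIV \<Longrightarrow> g (f x) = x" "\<And>x. x \<in> {x. e \<bullet> x = 0} \<Longrightarrow> f (g x) = x"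
    by (rule isometries_subspaces[OF subspace_UNIV subspace_hyperplane dims]) (rule that; simp)
  have fg: "linear f" "linear g" "f ` UNIV = {x. e \<bullet> x = 0}"
      "\<And>x. norm (f x) = norm x" "\<And>x. e \<bullet> x = 0 \<Longrightarrow> norm (g x) = norm x"
      "\<And>x. g (f x) = x" "\<And>x. e \<bullet> x = 0 \<Longrightarrow> f (g x) = x"
    by (fact fg0(1-3))+ (simp_all add: fg0)
  have ef: "e \<bullet> f q = 0" for q using fg(3) by auto
  define p where "p x = g (x - (e \<bullet> x) *\<^sub>R e)" for x
  define \<phi> where "\<phi> q = f q + sqrt (1 - (norm q)\<^sup>2) *\<^sub>R e" for q
  \<comment> \<open>If the component along \<open>e\<close> is at most \<open>\<eta> * |x|\<close>, the rest has norm at least \<open>sqrt (1 - \<eta>\<^sup>2) * |x| = |x| / L\<close>.\<close>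
  define \<eta> where "\<eta> = sqrt (1 - 1 / L\<^sup>2)"
  have L2: "1 < L\<^sup>2" using L by (simp add: one_less_power)
  then have \<eta>: "0 < \<eta>" "\<eta>\<^sup>2 = 1 - 1 / L\<^sup>2" "\<eta> < 1"
    using L by (auto simp: \<eta>_def real_sqrt_lt_1_iff divide_less_eq_1 divide_le_eq_1)
  have orth: "e \<bullet> (x - (e \<bullet> x) *\<^sub>R e) = 0" for x by (simp add: inner_diff_right ee)
  have pdiff: "p x - p y = p (x - y)" for x y
    unfolding p_def linear_diff[OF fg(2), symmetric]
    by (simp add: inner_diff_right scaleR_diff_left algebra_simps)
  have pnorm: "(norm (p x))\<^sup>2 = (norm x)\<^sup>2 - (e \<bullet> x)\<^sup>2" for x
    unfolding p_def fg(5)[OF orth]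
    unfolding power2_norm_eq_inner
    by (simp add: inner_diff_left inner_diff_right ee inner_commute[of x e] power2_eq_square)
  have p\<phi>: "p (\<phi> q) = q" for q
    by (simp add: p_def \<phi>_def inner_add_right ef ee fg(6))
  show thesis
  proof (rule that[of \<phi> p \<eta>])
    have "continuous_on UNIV f" using fg(1) by (simp add: linear_continuous_on linear_conv_bounded_linear)
    then show "continuous_on UNIV \<phi>" unfolding \<phi>_def by (intro continuous_intros)
    show "dist (p x) (p y) \<le> dist x y" for x y
    proof -
      have "(norm (p (x - y)))\<^sup>2 \<le> (norm (x - y))\<^sup>2" by (simp add: pnorm)
      then have "norm (p (x - y)) \<le> norm (x - y)" by (rule power2_le_imp_le) simp
      then show ?thesis by (simp add: dist_norm pdiff)
    qed
    show "ball 0 1 \<subseteq> p ` sphere 0 1"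
    proof
      fix q :: 'j assume "q \<in> ball 0 1"
      then have "norm q \<le> 1" by simp
      then have "(norm q)\<^sup>2 \<le> 1" by (rule power_le_one[OF norm_ge_zero])
      then have "(norm (\<phi> q))\<^sup>2 = 1"
        unfolding \<phi>_def
        by (subst norm_add_Pythagorean)
          (auto simp: orthogonal_def inner_commute ef fg(4) e power_mult_distrib)
      then have "\<phi> q \<in> sphere 0 1"
        using norm_ge_zero[of "\<phi> q"] by (auto simp: power2_eq_1_iff simp del: norm_ge_zero)
      then show "q \<in> p ` sphere 0 1" using p\<phi>[of q] by (metis image_eqI)
    qed
    show "\<phi> (p \<theta>) = \<theta>" if "\<theta> \<in> sphere 0 1 \<inter> ball e \<eta>" for \<theta>
    proof -
      have \<theta>: "norm \<theta> = 1" "norm (e - \<theta>) < 1" using that \<eta>(3) by (auto simp: dist_norm)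
      have "(norm (e - \<theta>))\<^sup>2 < 1" using \<theta>(2) by (simp add: power_less_one_iff)
      moreover have "\<theta> \<bullet> \<theta> = 1" using \<theta>(1) by (simp add: dot_square_norm)
      ultimately have "0 < e \<bullet> \<theta>"
        unfolding power2_norm_eq_inner
        by (simp add: inner_diff_left inner_diff_right inner_commute[of \<theta> e] ee)
      then have "sqrt (1 - (norm (p \<theta>))\<^sup>2) = e \<bullet> \<theta>" by (simp add: pnorm \<theta>)
      moreover have "f (p \<theta>) = \<theta> - (e \<bullet> \<theta>) *\<^sub>R e" unfolding p_def by (rule fg(7)[OF orth])
      ultimately show ?thesis by (simp add: \<phi>_def)
    qed
    show "dist \<theta> \<theta>' \<le> L * dist (p \<theta>) (p \<theta>')"
      if "\<theta> \<in> sphere 0 1 \<inter> ball e \<eta>" "\<theta>' \<in> sphere 0 1 \<inter> ball e \<eta>" for \<theta> \<theta>'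
    proof -
      have n: "norm \<theta> = 1" "norm \<theta>' = 1" "norm (e - \<theta>) < \<eta>" "norm (e - \<theta>') < \<eta>"
        using that by (auto simp: dist_norm)
      have "\<theta> \<bullet> \<theta> = 1" "\<theta>' \<bullet> \<theta>' = 1" using n by (simp_all add: dot_square_norm)
      then have "(\<theta> - \<theta>') \<bullet> (\<theta> + \<theta>') = 0"
        by (simp add: inner_diff_left inner_add_right inner_commute[of \<theta> \<theta>'])
      then have "e \<bullet> (\<theta> - \<theta>') = (\<theta> - \<theta>') \<bullet> ((1/2) *\<^sub>R ((e - \<theta>) + (e - \<theta>')))"
        by (simp add: inner_diff_left inner_diff_right inner_add_right inner_commute[of e] algebra_simps)
      then have "\<bar>e \<bullet> (\<theta> - \<theta>')\<bar> \<le> norm (\<theta> - \<theta>') * norm ((1/2) *\<^sub>R ((e - \<theta>) + (e - \<theta>')))"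
        by (metis Cauchy_Schwarz_ineq2)
      also have "\<dots> \<le> norm (\<theta> - \<theta>') * \<eta>"
        using norm_triangle_ineq[of "e - \<theta>" "e - \<theta>'"] n by (intro mult_left_mono) auto
      finally have "(e \<bullet> (\<theta> - \<theta>'))\<^sup>2 \<le> (norm (\<theta> - \<theta>') * \<eta>)\<^sup>2"
        by (metis abs_le_square_iff abs_ge_self order_trans)
      then have "(norm (\<theta> - \<theta>'))\<^sup>2 / L\<^sup>2 \<le> (norm (p (\<theta> - \<theta>')))\<^sup>2"
        by (simp add: pnorm power_mult_distrib \<eta> algebra_simps)
      then have "(norm (\<theta> - \<theta>'))\<^sup>2 \<le> (L * norm (p (\<theta> - \<theta>')))\<^sup>2"
        using L by (simp add: power_mult_distrib pos_divide_le_eq mult.commute)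
      then have "norm (\<theta> - \<theta>') \<le> L * norm (p (\<theta> - \<theta>'))" by (rule power2_le_imp_le) (use L in simp)
      then show ?thesis by (simp add: dist_norm pdiff)
    qed
  qed (use \<eta> p\<phi> in auto)
qed

text \<open>The set \<open>\<phi> -` P\<close> equals \<open>p ` P\<close>. It is written as a preimage because preimages of Borel sets are
Borel.\<close>

lemma vol_bilipschitz_chart:
  fixes P :: "'b::euclidean_space set" and p :: "'b \<Rightarrow> 'c::euclidean_space"
  assumes P: "P \<in> sets borel" and Q: "\<phi> -` P \<in> sets borel" 
    and inv: "\<And>q. p (\<phi> q) = q" "\<And>x. x \<in> P \<Longrightarrow> \<phi> (p x) = x"
    and lip: "\<And>x y. dist (p x) (p y) \<le> dist x y"
    and lip': "\<And>x y. x \<in> P \<Longrightarrow> y \<in> P \<Longrightarrow> dist x y \<le> L * dist (p x) (p y)"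
    and L: "1 < L" and dim: "DIM('c) \<le> DIM('b)"
  shows "emeasure lborel (\<phi> -` P) \<le> vol DIM('c) P"
    and "vol DIM('c) P \<le> ennreal (L ^ DIM('c)) * emeasure lborel (\<phi> -` P)"
proof -
  have img: "\<phi> -` P = p ` P"
  proof (intro subset_antisym subsetI)
    fix q assume "q \<in> \<phi> -` P"
    then show "q \<in> p ` P" using inv(1)[of q] by (metis imageI vimageE)
  qed (auto simp: inv)
  have "emeasure lborel (\<phi> -` P) = vol DIM('c) (p ` P)"
    using vol_eq_lborel[OF Q] by (simp add: img)
  then show "emeasure lborel (\<phi> -` P) \<le> vol DIM('c) P"
    using vol_lipschitz[of P p 1 "DIM('c)"] lip dim
    by simp
  have "vol DIM('c) P \<le> ennreal (L ^ DIM('c)) * vol DIM('c) (p ` P)"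
    using lip' L dim by (intro vol_le_of_expanding) auto
  then show "vol DIM('c) P \<le> ennreal (L ^ DIM('c)) * emeasure lborel (\<phi> -` P)"
    using vol_eq_lborel[OF Q] by (simp add: img)
qed

lemma borel_Times: "A \<in> sets borel \<Longrightarrow> B \<in> sets borel \<Longrightarrow> (A::'a::second_countable_topology set) \<times> (B::'b::second_countable_topology set) \<in> sets borel"
  by (metis borel_prod pair_measureI)

lemma emeasure_lborel_Times:
  fixes A :: "'a::euclidean_space set" and B :: "'b::euclidean_space set"
  assumes "A \<in> sets borel" "B \<in> sets borel"
  shows "emeasure lborel (A \<times> B) = emeasure lborel A * emeasure lborel B"
  using assms lborel.emeasure_pair_measure_Times[of A lborel B] by (simp add: lborel_prod)

text \<open>Here \<open>q\<close> is the total Lebesgue measure of the projections of the pieces into which small caps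
cut the sphere. It compares the volume of the sphere with that of the product, and the
comparison does not mention the pieces any more.\<close>

lemma sphere_chart_comparison:
  fixes E :: "'a::euclidean_space set"
  assumes dim: "DIM('j::euclidean_space) + 1 = DIM('b)" and E: "E \<in> sets borel" and L: "1 < L"
  obtains q where "vol DIM('j::euclidean_space) (sphere (0::'b::euclidean_space) 1) < top"
    "q \<le> vol DIM('j::euclidean_space) (sphere (0::'b::euclidean_space) 1)"
    "vol DIM('j::euclidean_space) (sphere (0::'b::euclidean_space) 1) \<le> ennreal (L ^ DIM('j::euclidean_space)) * q"
    "emeasure lborel E * q \<le> vol DIM('a \<times> 'j::euclidean_space) (E \<times> sphere (0::'b::euclidean_space) 1)"
    "vol DIM('a \<times> 'j::euclidean_space) (E \<times> sphere (0::'b::euclidean_space) 1) \<le> ennreal (L ^ DIM('a \<times> 'j::euclidean_space)) * (emeasure lborel E * q)"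
proof -
  let ?S = "sphere (0::'b) 1"
  define chart where "chart e p \<phi> \<eta> \<longleftrightarrow> continuous_on UNIV \<phi> \<and> (\<forall>q. p (\<phi> q) = q) \<and>
      (\<forall>x y. dist (p x) (p y) \<le> dist x y) \<and> 0 < \<eta> \<and>
      (\<forall>\<theta> \<in> ?S \<inter> ball e \<eta>. \<phi> (p \<theta>) = \<theta>) \<and>
      (\<forall>\<theta> \<in> ?S \<inter> ball e \<eta>. \<forall>\<theta>' \<in> ?S \<inter> ball e \<eta>. dist \<theta> \<theta>' \<le> L * dist (p \<theta>) (p \<theta>'))"
    for e :: 'b and p :: "'b \<Rightarrow> 'j" and \<phi> \<eta>
  have "\<exists>p \<phi> \<eta>. chart e p \<phi> \<eta>" if "e \<in> ?S" for e
  proof -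
    from that have "norm e = 1" by simp
    then show ?thesis
      by (rule sphere_cap_chart[OF dim _ L]) (unfold chart_def, blast)
  qed
  then obtain p \<phi> \<eta> where ch: "\<And>e. e \<in> ?S \<Longrightarrow> chart e (p e) (\<phi> e) (\<eta> e)"
    by metis
  have c\<phi>: "continuous_on UNIV (\<phi> e)" and p\<phi>: "\<And>q. p e (\<phi> e q) = q"
    and lip: "\<And>x y. dist (p e x) (p e y) \<le> dist x y" and \<eta>: "0 < \<eta> e"
    and \<phi>p: "\<And>\<theta>. \<theta> \<in> ?S \<inter> ball e (\<eta> e) \<Longrightarrow> \<phi> e (p e \<theta>) = \<theta>"
    and lip': "\<And>\<theta> \<theta>'. \<theta> \<in> ?S \<inter> ball e (\<eta> e) \<Longrightarrow> \<theta>' \<in> ?S \<inter> ball e (\<eta> e) \<Longrightarrow>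
       dist \<theta> \<theta>' \<le> L * dist (p e \<theta>) (p e \<theta>')" if "e \<in> ?S" for e
    using ch[OF that] unfolding chart_def by blast+
  obtain C where C: "C \<subseteq> ?S" "finite C" "?S \<subseteq> (\<Union>e\<in>C. ball e (\<eta> e))"
    using compactE_image[of ?S ?S "\<lambda>e. ball e (\<eta> e)"] \<eta> by (metis (no_types, lifting) UN_I centre_in_ball compact_sphere open_ball subsetI)
  have "?S \<noteq> {}" using vector_choose_size[of 1] by (metis ex_in_conv mem_sphere_0 zero_le_one)
  then have "C \<noteq> {}" using C by auto
  define e where "e = from_nat_into C"
  have e: "e i \<in> ?S" for i using from_nat_into[OF \<open>C \<noteq> {}\<close>, of i] C(1) by (auto simp only: e_def)
  have Cr: "range e = C" unfolding e_def using C \<open>C \<noteq> {}\<close> by (simp add: range_from_nat_into countable_finite)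
  define P where "P i = ?S \<inter> disjointed (\<lambda>i. ball (e i) (\<eta> (e i))) i" for i
  have Pb: "P i \<in> sets borel" for i
    unfolding P_def disjointed_def by (intro sets.Int sets.Diff sets.finite_UN) auto
  have PS: "(\<Union>i. P i) = ?S"
    using C(3) Cr by (auto simp: P_def UN_disjointed_eq simp flip: Int_UN_distrib)
  have disj: "disjoint_family P"
    unfolding P_def using disjoint_family_disjointed[of "\<lambda>i. ball (e i) (\<eta> (e i))"]
    by (auto simp: disjoint_family_on_def)
  have Pball: "P i \<subseteq> ?S \<inter> ball (e i) (\<eta> (e i))" for i
    using disjointed_subset[of "\<lambda>i. ball (e i) (\<eta> (e i))" i] by (auto simp: P_def)
  define Q where "Q i = \<phi> (e i) -` P i" for i
  have Qb: "Q i \<in> sets borel" for i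
    unfolding Q_def using Pb[of i] borel_measurable_continuous_onI[OF c\<phi>[OF e]] measurable_sets_borel by blast
  have P1: "emeasure lborel (Q i) \<le> vol DIM('j) (P i)"
    "vol DIM('j) (P i) \<le> ennreal (L ^ DIM('j)) * emeasure lborel (Q i)" for i
    unfolding Q_def using vol_bilipschitz_chart[OF Pb Qb[unfolded Q_def], of "p (e i)" i L] p\<phi>[OF e] \<phi>p[OF e] lip[OF e] lip'[OF e] L dim Pball[of i]
    by (simp_all add: subset_iff)
  have P2: "emeasure lborel E * emeasure lborel (Q i) \<le> vol DIM('a \<times> 'j) (E \<times> P i)"
    "vol DIM('a \<times> 'j) (E \<times> P i) \<le> ennreal (L ^ DIM('a \<times> 'j)) * (emeasure lborel E * emeasure lborel (Q i))" for i
  proof -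
    let ?p = "map_prod id (p (e i)) :: 'a \<times> 'b \<Rightarrow> 'a \<times> 'j" and ?\<phi> = "map_prod id (\<phi> (e i)) :: 'a \<times> 'j \<Rightarrow> 'a \<times> 'b"
    have Q2: "?\<phi> -` (E \<times> P i) = E \<times> Q i" by (auto simp: Q_def)
    have l1: "dist (?p x) (?p y) \<le> dist x y" for x y
      using lip[OF e[of i], of "snd x" "snd y"] by (auto simp: dist_prod_def)
    have l2: "dist x y \<le> L * dist (?p x) (?p y)" if "x \<in> E \<times> P i" "y \<in> E \<times> P i" for x y
    proof -
      have "dist (snd x) (snd y) \<le> L * dist (p (e i) (snd x)) (p (e i) (snd y))"
        using that Pball[of i] by (intro lip'[OF e] subsetD[OF Pball]) (auto simp: mem_Times_iff)
      moreover have "dist (fst x) (fst y) \<le> L * dist (fst x) (fst y)" using L by (simp add: mult_le_cancel_right1)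
      ultimately have "sqrt ((dist (fst x) (fst y))\<^sup>2 + (dist (snd x) (snd y))\<^sup>2) \<le>
        sqrt ((L * dist (fst x) (fst y))\<^sup>2 + (L * dist (p (e i) (snd x)) (p (e i) (snd y)))\<^sup>2)"
        by (intro real_sqrt_le_mono add_mono power_mono) auto
      also have "\<dots> = L * dist (?p x) (?p y)"
        using L by (simp add: dist_prod_def power_mult_distrib real_sqrt_mult flip: distrib_left)
      finally show ?thesis by (simp add: dist_prod_def)
    qed
    have inv: "?\<phi> (?p x) = x" if "x \<in> E \<times> P i" for x
      using that \<phi>p[OF e subsetD[OF Pball]] by auto
    have EPb: "E \<times> P i \<in> sets borel" "E \<times> Q i \<in> sets borel" using E Pb Qb by (auto intro: borel_Times)
    note * = vol_bilipschitz_chart[of "E \<times> P i" ?\<phi> ?p L, unfolded Q2, OF EPb]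
    have "emeasure lborel (E \<times> Q i) \<le> vol DIM('a \<times> 'j) (E \<times> P i)"
      by (rule *(1)) (use p\<phi>[OF e] inv l1 l2 L dim in auto)
    moreover have "vol DIM('a \<times> 'j) (E \<times> P i) \<le> ennreal (L ^ DIM('a \<times> 'j)) * emeasure lborel (E \<times> Q i)"
      by (rule *(2)) (use p\<phi>[OF e] inv l1 l2 L dim in auto)
    ultimately show "emeasure lborel E * emeasure lborel (Q i) \<le> vol DIM('a \<times> 'j) (E \<times> P i)"
    "vol DIM('a \<times> 'j) (E \<times> P i) \<le> ennreal (L ^ DIM('a \<times> 'j)) * (emeasure lborel E * emeasure lborel (Q i))"
      by (simp_all add: emeasure_lborel_Times[OF E Qb])
  qed
  have S1: "vol DIM('j) ?S = (\<Sum>i. vol DIM('j) (P i))"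
    using vol_suminf[OF disj Pb] by (simp add: PS)
  have S2: "vol DIM('a \<times> 'j) (E \<times> ?S) = (\<Sum>i. vol DIM('a \<times> 'j) (E \<times> P i))"
  proof -
    have "E \<times> ?S = (\<Union>i. E \<times> P i)" using PS by blast
    then show ?thesis using disj E Pb
      by (simp only:) (rule vol_suminf, auto simp: disjoint_family_on_def intro: borel_Times)
  qed
  show thesis
  proof (rule that[of "\<Sum>i. emeasure lborel (Q i)"])
    show "(\<Sum>i. emeasure lborel (Q i)) \<le> vol DIM('j) ?S"
      unfolding S1 by (intro suminf_le P1) auto
    show "vol DIM('j) ?S \<le> ennreal (L ^ DIM('j)) * (\<Sum>i. emeasure lborel (Q i))"
      unfolding S1 ennreal_suminf_cmult[symmetric] by (intro suminf_le P1) auto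
    show "emeasure lborel E * (\<Sum>i. emeasure lborel (Q i)) \<le> vol DIM('a \<times> 'j) (E \<times> ?S)"
      unfolding S2 ennreal_suminf_cmult[symmetric] by (intro suminf_le P2) auto
    show "vol DIM('a \<times> 'j) (E \<times> ?S) \<le> ennreal (L ^ DIM('a \<times> 'j)) * (emeasure lborel E * (\<Sum>i. emeasure lborel (Q i)))"
      unfolding S2 ennreal_suminf_cmult[symmetric] by (intro suminf_le P2) auto
    have "vol DIM('j) (?S \<inter> ball c (\<eta> c)) < top" if "c \<in> C" for c
    proof -
      have c: "c \<in> ?S" using that C by auto
      have b: "?S \<inter> ball c (\<eta> c) \<in> sets borel" by auto
      have Qc: "\<phi> c -` (?S \<inter> ball c (\<eta> c)) \<in> sets borel"
        using b borel_measurable_continuous_onI[OF c\<phi>[OF c]] measurable_sets_borel by blast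
      have "vol DIM('j) (?S \<inter> ball c (\<eta> c)) \<le> ennreal (L ^ DIM('j)) * emeasure lborel (\<phi> c -` (?S \<inter> ball c (\<eta> c)))"
        by (rule vol_bilipschitz_chart(2)[OF b Qc p\<phi>[OF c] \<phi>p[OF c] lip[OF c] lip'[OF c] L]) (use dim in auto)
      also have "\<dots> \<le> ennreal (L ^ DIM('j)) * emeasure lborel (ball (p c c) (\<eta> c))"
      proof (intro mult_left_mono emeasure_mono subsetI)
        fix q assume "q \<in> \<phi> c -` (?S \<inter> ball c (\<eta> c))"
        then show "q \<in> ball (p c c) (\<eta> c)"
          using lip[OF c, of c "\<phi> c q"] p\<phi>[OF c, of q] by auto
      qed auto
      also have "\<dots> < top" 
        by (simp add: ennreal_mult_less_top emeasure_bounded_finite[OF bounded_ball, simplified])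
      finally show ?thesis .
    qed
    then have "(\<Sum>c\<in>C. vol DIM('j) (?S \<inter> ball c (\<eta> c))) < top" by (simp add: C(2))
    moreover have "?S = (\<Union>c\<in>C. ?S \<inter> ball c (\<eta> c))" using C by blast
    ultimately show "vol DIM('j) ?S < top"
      using vol_finite_UN_le[OF C(2), of "DIM('j)" "\<lambda>c. ?S \<inter> ball c (\<eta> c)"] by (metis le_less_trans)
  qed
qed

text \<open>The projection of the sphere onto a hyperplane through its centre covers the unit ball.\<close>

lemma vol_sphere_pos:
  assumes dim: "DIM('j::euclidean_space) + 1 = DIM('b)"
  shows "0 < vol DIM('j) (sphere (0::'b::euclidean_space) 1)"
proof -
  obtain e :: 'b where "norm e = 1" using vector_choose_size[of 1] by auto
  then obtain p :: "'b \<Rightarrow> 'j" where p: "\<And>x y. dist (p x) (p y) \<le> dist x y" "ball 0 1 \<subseteq> p ` sphere 0 1"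
    by (rule sphere_cap_chart[OF dim, of e 2]) (simp, rule that)
  have "0 < emeasure lborel (ball (0::'j) 1)" by (simp add: emeasure_ball)
  also have "\<dots> = vol DIM('j) (ball (0::'j) 1)" by (simp add: vol_eq_lborel)
  also have "\<dots> \<le> vol DIM('j) (p ` sphere 0 1)" by (intro vol_mono p)
  also have "\<dots> \<le> ennreal (1 ^ DIM('j)) * vol DIM('j) (sphere (0::'b) 1)"
    using dim p by (intro vol_lipschitz) auto
  finally show ?thesis by simp
qed

lemma vol_sphere_finite:
  assumes dim: "DIM('j::euclidean_space) + 1 = DIM('b)"
  shows "vol DIM('j) (sphere (0::'b::euclidean_space) 1) < top"
  by (rule sphere_chart_comparison[OF dim, of "{} :: real set" 2]) auto

text \<open>Both sides lie between \<open>Leb(E) * q\<close> and a power of \<open>L\<close> times \<open>Leb(E) * q\<close>, with the same \<open>q\<close>.\<close>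

theorem vol_Times_sphere:
  fixes E :: "'a::euclidean_space set"
  assumes dim: "DIM('j::euclidean_space) + 1 = DIM('b)" and E: "E \<in> sets borel"
  shows "vol DIM('a \<times> 'j) (E \<times> sphere (0::'b::euclidean_space) 1)
    = emeasure lborel E * vol DIM('j) (sphere (0::'b) 1)"
proof -
  let ?X1 = "vol DIM('j) (sphere (0::'b) 1)"
  let ?X2 = "vol DIM('a \<times> 'j) (E \<times> sphere (0::'b) 1)"
  have "?X2 \<le> ennreal (L ^ DIM('a \<times> 'j)) * (emeasure lborel E * ?X1)"
    and "emeasure lborel E * ?X1 \<le> ennreal (L ^ DIM('j)) * ?X2" if L: "1 < L" for L
  proof -
    obtain q where q: "q \<le> ?X1" "?X1 \<le> ennreal (L ^ DIM('j)) * q" "emeasure lborel E * q \<le> ?X2"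
        "?X2 \<le> ennreal (L ^ DIM('a \<times> 'j)) * (emeasure lborel E * q)"
      by (rule sphere_chart_comparison[OF dim E L])
    show "?X2 \<le> ennreal (L ^ DIM('a \<times> 'j)) * (emeasure lborel E * ?X1)"
      by (rule order_trans[OF q(4)]) (intro mult_left_mono q(1); simp)
    have "emeasure lborel E * ?X1 \<le> emeasure lborel E * (ennreal (L ^ DIM('j)) * q)"
      by (intro mult_left_mono q(2)) simp
    also have "\<dots> = ennreal (L ^ DIM('j)) * (emeasure lborel E * q)" by (simp add: ac_simps)
    also have "\<dots> \<le> ennreal (L ^ DIM('j)) * ?X2" by (intro mult_left_mono q(3)) simp
    finally show "emeasure lborel E * ?X1 \<le> ennreal (L ^ DIM('j)) * ?X2" .
  qed
  then show ?thesis by (intro antisym) (rule ennreal_le_of_le_power_mult, blast)+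
qed

lemma vol_Times_scaled_sphere:
  fixes E :: "'a::euclidean_space set"
  assumes dim: "DIM('j::euclidean_space) + 1 = DIM('b)" and E: "E \<in> sets borel" and r: "0 < r"
  shows "vol DIM('a \<times> 'j) (E \<times> sphere (0::'b::euclidean_space) r)
    = ennreal (r ^ DIM('j)) * emeasure lborel E * vol DIM('j) (sphere (0::'b) 1)"
proof -
  let ?E = "(*\<^sub>R) (1 / r) ` E"
  have eq: "?E = (*\<^sub>R) r -` E" using r by (force simp: image_iff)
  have Eb: "?E \<in> sets borel"
    unfolding eq by (rule measurable_sets_borel[where M = borel, OF _ E]) simp
  have S: "sphere (0::'b) r = (*\<^sub>R) r ` sphere 0 1"
  proof (intro subset_antisym subsetI)
    fix x :: 'b assume "x \<in> sphere 0 r"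
    then have "(1 / r) *\<^sub>R x \<in> sphere 0 1" "x = r *\<^sub>R ((1 / r) *\<^sub>R x)" using r by auto
    then show "x \<in> (*\<^sub>R) r ` sphere 0 1" by blast
  qed (use r in auto)
  have "E \<times> sphere (0::'b) r = (*\<^sub>R) r ` (?E \<times> sphere 0 1)"
    unfolding S using r by (force simp: image_iff scaleR_prod_def)
  then have "vol DIM('a \<times> 'j) (E \<times> sphere (0::'b) r)
      = ennreal (r ^ DIM('a \<times> 'j)) * (emeasure lborel ?E * vol DIM('j) (sphere (0::'b) 1))"
    by (simp only: vol_scale[OF r] vol_Times_sphere[OF dim Eb])
  also have "emeasure lborel ?E = ennreal ((1 / r) ^ DIM('a)) * emeasure lborel E"
    using emeasure_lebesgue_affine[of "1 / r" 0 E] r Eb E by simp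
  also have "ennreal (r ^ DIM('a \<times> 'j)) * (ennreal ((1 / r) ^ DIM('a)) * emeasure lborel E * vol DIM('j) (sphere (0::'b) 1))
     = (ennreal (r ^ DIM('a \<times> 'j)) * ennreal ((1 / r) ^ DIM('a))) * emeasure lborel E * vol DIM('j) (sphere (0::'b) 1)"
    by (simp only: mult.assoc)
  also have "ennreal (r ^ DIM('a \<times> 'j)) * ennreal ((1 / r) ^ DIM('a)) = ennreal (r ^ DIM('j))"
    using r by (simp add: power_add power_divide flip: ennreal_mult)
  finally show ?thesis .
qed

section \<open>Volume of a spherical array over a small ball\<close>

lemma borel_linear_image:
  fixes T :: "'a::euclidean_space \<Rightarrow> 'a"
  assumes T: "linear T" "inj T" and E: "E \<in> sets borel"
  shows "T ` E \<in> sets borel"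
proof -
  have surj: "surj T" by (rule linear_injective_imp_surjective[OF T refl])
  have lin: "linear (inv T)" using T by (rule inj_linear_imp_inv_linear)
  have "continuous_on UNIV (inv T)"
    by (rule linear_continuous_on) (use lin in \<open>simp add: linear_conv_bounded_linear\<close>)
  then have "inv T -` E \<in> sets borel"
    using E borel_measurable_continuous_onI measurable_sets_borel by blast
  moreover have "inv T -` E = T ` E"
  proof (intro subset_antisym subsetI)
    fix x assume "x \<in> inv T -` E"
    then show "x \<in> T ` E" using surj_f_inv_f[OF surj, of x] by (metis imageI vimageE)
  qed (use T(2) in auto)
  ultimately show ?thesis by simp
qed

text \<open>The map is \<open>D \<circ> Q\<close>, where the orthogonal transformation \<open>Q\<close> takes \<open>g\<close>
to a multiple of a basis vector \<open>b\<close> and \<open>D\<close> stretches the direction \<open>b\<close> by \<open>s = sqrt (1 + |g|\<^sup>2)\<close>.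
Isometries preserve Lebesgue measure because it is a multiple of Hausdorff measure.\<close>

lemma stretch_map_exists:
  fixes g :: "real ^ 'm"
  obtains T :: "real ^ 'm \<Rightarrow> real ^ 'm" where
    "linear T" "\<And>x. (norm (T x))\<^sup>2 = (norm x)\<^sup>2 + (g \<bullet> x)\<^sup>2"
    "\<And>E. E \<in> sets borel \<Longrightarrow> T ` E \<in> sets borel"
    "\<And>E. E \<in> sets borel \<Longrightarrow> emeasure lborel (T ` E) = ennreal (sqrt (1 + (norm g)\<^sup>2)) * emeasure lborel E"
proof -
  obtain b :: "real ^ 'm" where b: "b \<in> Basis" by (meson nonempty_Basis ex_in_conv)
  then have bb: "b \<bullet> b = 1" by (simp add: inner_Basis)
  have "norm g = norm (norm g *\<^sub>R b)" using b by simp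
  then obtain Q where Q: "orthogonal_transformation Q" "Q g = norm g *\<^sub>R b"
    by (rule orthogonal_transformation_exists)
  have Qn: "norm (Q x) = norm x" for x using Q(1) by (simp add: orthogonal_transformation)
  have Qlin: "linear Q" and Qinj: "inj Q"
    using Q(1) by (auto simp: orthogonal_transformation_linear orthogonal_transformation_inj)
  have Qg: "g \<bullet> x = norm g * (b \<bullet> Q x)" for x
    using Q unfolding orthogonal_transformation_def by (metis inner_scaleR_left)
  define s where "s = sqrt (1 + (norm g)\<^sup>2)"
  have s: "0 < s" "s\<^sup>2 = 1 + (norm g)\<^sup>2" unfolding s_def by (auto simp: add_pos_nonneg)
  define D where "D z = z + ((s - 1) * (b \<bullet> z)) *\<^sub>R b" for z
  have Dlin: "linear D" unfolding D_def
    by (rule linearI) (simp_all add: inner_add_right algebra_simps)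
  have Dnorm: "(norm (D z))\<^sup>2 = (norm z)\<^sup>2 + (norm g)\<^sup>2 * (b \<bullet> z)\<^sup>2" for z
  proof -
    have "(norm (D z))\<^sup>2 = (norm z)\<^sup>2 + (s\<^sup>2 - 1) * (b \<bullet> z)\<^sup>2"
      unfolding D_def power2_norm_eq_inner
      by (simp add: inner_add_left inner_add_right bb inner_commute[of z b] power2_eq_square algebra_simps)
    then show ?thesis using s(2) by simp
  qed
  have Dinj: "inj D"
  proof (rule linear_injective_0[OF Dlin, THEN iffD2], intro allI impI)
    fix z assume "D z = 0"
    then have "(norm z)\<^sup>2 + (norm g)\<^sup>2 * (b \<bullet> z)\<^sup>2 = 0" using Dnorm[of z] by simp
    then have "(norm z)\<^sup>2 = 0" by (smt (verit) zero_le_power2 mult_nonneg_nonneg)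
    then show "z = 0" by simp
  qed
  have Dsum: "D = (\<lambda>z. 0 + (\<Sum>j\<in>Basis. ((if j = b then s else 1) * (z \<bullet> j)) *\<^sub>R j))"
  proof
    fix z
    have "(\<Sum>j\<in>Basis. ((if j = b then s else 1) * (z \<bullet> j)) *\<^sub>R j)
        = (\<Sum>j\<in>Basis. (z \<bullet> j) *\<^sub>R j + (if j = b then ((s - 1) * (z \<bullet> b)) *\<^sub>R b else 0))"
      by (intro sum.cong) (auto simp: algebra_simps)
    also have "\<dots> = z + ((s - 1) * (z \<bullet> b)) *\<^sub>R b"
      using b by (simp add: sum.distrib euclidean_representation)
    finally show "D z = 0 + (\<Sum>j\<in>Basis. ((if j = b then s else 1) * (z \<bullet> j)) *\<^sub>R j)"
      by (simp add: D_def inner_commute)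
  qed
  have prod: "(\<Prod>j\<in>Basis. \<bar>if j = b then s else 1\<bar>) = s"
    using b s(1) by (simp add: if_distrib[of abs] cong: if_cong)
  have lebD: "lborel = density (distr lborel borel D) (\<lambda>_. ennreal s)"
  proof -
    have "lborel = density (distr lborel borel (\<lambda>z. 0 + (\<Sum>j\<in>Basis. ((if j = b then s else 1) * (z \<bullet> j)) *\<^sub>R j)))
        (\<lambda>_. ennreal (\<Prod>j\<in>Basis. \<bar>if j = b then s else 1\<bar>))"
      by (rule lborel_affine_euclidean) (use s(1) in auto)
    then show ?thesis unfolding prod Dsum[symmetric] .
  qed
  have Dmeas: "D \<in> borel \<rightarrow>\<^sub>M borel"
    by (intro borel_measurable_continuous_onI linear_continuous_on) (use Dlin in \<open>simp add: linear_conv_bounded_linear\<close>)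
  have emD: "emeasure lborel (D ` E) = ennreal s * emeasure lborel E" if E: "E \<in> sets borel" for E
  proof -
    have DE: "D ` E \<in> sets borel" using Dlin Dinj E by (rule borel_linear_image)
    have "emeasure lborel (D ` E) = emeasure (density (distr lborel borel D) (\<lambda>_. ennreal s)) (D ` E)"
      by (rule arg_cong[OF lebD, where f = "\<lambda>M. emeasure M (D ` E)"])
    also have "\<dots> = ennreal s * emeasure (distr lborel borel D) (D ` E)"
      using DE by (subst emeasure_density) (auto simp: nn_integral_cmult)
    also have "\<dots> = ennreal s * emeasure lborel (D -` (D ` E))"
      using DE Dmeas by (subst emeasure_distr) auto
    finally show ?thesis by (simp add: inj_vimage_image_eq[OF Dinj])
  qed
  have emQ: "emeasure lborel (Q ` E) = emeasure lborel E" if E: "E \<in> sets borel" for E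
  proof -
    have "vol DIM(real ^ 'm) (Q ` E) = vol DIM(real ^ 'm) E"
      by (rule vol_isometric_image) (simp add: dist_norm Qn flip: linear_diff[OF Qlin])
    then show ?thesis using E borel_linear_image[OF Qlin Qinj E] by (simp only: vol_eq_lborel)
  qed
  show thesis
  proof (rule that[of "D \<circ> Q"])
    show "linear (D \<circ> Q)" using Qlin Dlin by (rule linear_compose)
    show "(norm ((D \<circ> Q) x))\<^sup>2 = (norm x)\<^sup>2 + (g \<bullet> x)\<^sup>2" for x
      by (simp add: Dnorm Qn Qg power_mult_distrib)
    show "(D \<circ> Q) ` E \<in> sets borel" if "E \<in> sets borel" for E
      unfolding image_comp[symmetric] by (intro borel_linear_image Dlin Dinj Qlin Qinj that)
    show "emeasure lborel ((D \<circ> Q) ` E) = ennreal (sqrt (1 + (norm g)\<^sup>2)) * emeasure lborel E"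
      if "E \<in> sets borel" for E
      unfolding image_comp[symmetric]
      using that by (simp add: emD emQ borel_linear_image Qlin Qinj s_def)
  qed
qed

lemma sum_squares_perturb:
  fixes a b c :: real
  assumes "\<bar>c - b\<bar> \<le> \<epsilon> * \<bar>a\<bar>" "0 \<le> \<epsilon>"
  shows "a\<^sup>2 + c\<^sup>2 \<le> (1 + \<epsilon>)\<^sup>2 * (a\<^sup>2 + b\<^sup>2)"
proof -
  have "norm (a, c) \<le> norm (a, b) + norm (0 :: real, c - b)"
    using norm_triangle_ineq[of "(a, b)" "(0, c - b)"] by simp
  also have "\<dots> \<le> norm (a, b) + \<epsilon> * \<bar>a\<bar>" using assms by simp
  also have "\<dots> \<le> norm (a, b) + \<epsilon> * norm (a, b)"
    using assms norm_fst_le[of a b] by (intro add_left_mono mult_left_mono) auto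
  finally have "norm (a, c) \<le> (1 + \<epsilon>) * norm (a, b)" by (simp add: algebra_simps)
  then have "(norm (a, c))\<^sup>2 \<le> ((1 + \<epsilon>) * norm (a, b))\<^sup>2" by (rule power_mono) simp
  then show ?thesis by (simp add: norm_Pair power_mult_distrib)
qed

text \<open>This splits the distance of two points of the array into a radial and a spherical part. The
spherical part is exactly the distance of the directions, scaled by the geometric mean of the
radii, and the comparison with a product is therefore good on whole spheres, not only on small caps.\<close>

lemma norm_diff_polar:
  fixes y y' :: "'b::real_inner"
  assumes "norm y = a" "norm y' = a'" "0 < a" "0 < a'"
  shows "(norm (y - y'))\<^sup>2 = (a - a')\<^sup>2 + a * a' * (norm ((1 / a) *\<^sub>R y - (1 / a') *\<^sub>R y'))\<^sup>2"
proof -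
  have yy: "y \<bullet> y = a\<^sup>2" "y' \<bullet> y' = a'\<^sup>2" using assms by (simp_all add: dot_square_norm)
  have "a * a' * (norm ((1 / a) *\<^sub>R y - (1 / a') *\<^sub>R y'))\<^sup>2 = 2 * a * a' - 2 * (y \<bullet> y')"
    unfolding power2_norm_eq_inner using assms(3,4)
    by (simp add: inner_diff_left inner_diff_right yy inner_commute[of y' y] field_simps power2_eq_square)
  moreover have "(norm (y - y'))\<^sup>2 = a\<^sup>2 + a'\<^sup>2 - 2 * (y \<bullet> y')"
    unfolding power2_norm_eq_inner by (simp add: inner_diff_left inner_diff_right yy inner_commute[of y' y])
  ultimately show ?thesis by (simp add: power2_diff)
qed

lemma dist_prod_squared:
  fixes z w :: "'a::real_normed_vector \<times> 'b::real_normed_vector"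
  shows "(dist z w)\<^sup>2 = (norm (fst z - fst w))\<^sup>2 + (norm (snd z - snd w))\<^sup>2"
  by (simp add: dist_prod_def dist_norm)

lemma locally_linear_of_continuous_gradient:
  fixes f :: "'a::euclidean_space \<Rightarrow> real"
  assumes "open \<Omega>" "x0 \<in> \<Omega>" "0 < \<epsilon>"
    and cont: "continuous_on \<Omega> g" and der: "\<And>x. x \<in> \<Omega> \<Longrightarrow> GDERIV f x :> g x"
  obtains \<rho> where "0 < \<rho>" "ball x0 \<rho> \<subseteq> \<Omega>"
    "\<And>x y. x \<in> ball x0 \<rho> \<Longrightarrow> y \<in> ball x0 \<rho> \<Longrightarrow> \<bar>f x - f y - g x0 \<bullet> (x - y)\<bar> \<le> \<epsilon> * norm (x - y)"
    "\<And>x. x \<in> ball x0 \<rho> \<Longrightarrow> \<bar>f x - f x0\<bar> \<le> \<epsilon>"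
proof -
  have "isCont g x0" using cont assms(1,2) by (simp add: continuous_on_eq_continuous_at)
  then obtain d1 where d1: "0 < d1" "\<And>x. dist x x0 < d1 \<Longrightarrow> dist (g x) (g x0) < \<epsilon>"
    unfolding continuous_at_eps_delta using assms(3) by blast
  have "isCont f x0"
    using der[OF assms(2)] unfolding gderiv_def by (rule has_derivative_continuous)
  then obtain d2 where d2: "0 < d2" "\<And>x. dist x x0 < d2 \<Longrightarrow> dist (f x) (f x0) < \<epsilon>"
    unfolding continuous_at_eps_delta using assms(3) by blast
  obtain d3 where d3: "0 < d3" "ball x0 d3 \<subseteq> \<Omega>" using assms(1,2) open_contains_ball by blast
  define \<rho> where "\<rho> = min d1 (min d2 d3)"
  show thesis
  proof (rule that[of \<rho>])
    show "0 < \<rho>" "ball x0 \<rho> \<subseteq> \<Omega>" using d1 d2 d3 by (auto simp: \<rho>_def)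
    show "\<bar>f x - f x0\<bar> \<le> \<epsilon>" if "x \<in> ball x0 \<rho>" for x
      using d2(2)[of x] that by (auto simp: \<rho>_def dist_real_def dist_commute)
    fix x y assume xy: "x \<in> ball x0 \<rho>" "y \<in> ball x0 \<rho>"
    have "norm (f x - f y - (x - y) \<bullet> g x0) \<le> norm (x - y) * \<epsilon>"
    proof (rule differentiable_bound_linearization[where S = "ball x0 \<rho>" and f' = "\<lambda>x h. h \<bullet> g x"])
      show "y + t *\<^sub>R (x - y) \<in> ball x0 \<rho>" if "t \<in> {0..1}" for t
      proof -
        have "(1 - t) *\<^sub>R y + t *\<^sub>R x \<in> ball x0 \<rho>"
          using convex_ball[of x0 \<rho>] xy that unfolding convex_alt by auto
        then show ?thesis by (simp add: algebra_simps)
      qed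
      show "x0 \<in> ball x0 \<rho>" using \<open>0 < \<rho>\<close> by simp
      fix z assume z: "z \<in> ball x0 \<rho>"
      then have "z \<in> \<Omega>" using \<open>ball x0 \<rho> \<subseteq> \<Omega>\<close> by blast
      then show "(f has_derivative (\<lambda>h. h \<bullet> g z)) (at z within ball x0 \<rho>)"
        using der unfolding gderiv_def by (blast intro: has_derivative_at_withinI)
      have "norm (g z - g x0) \<le> \<epsilon>" using d1(2)[of z] z by (auto simp: \<rho>_def dist_norm norm_minus_commute)
      then have "\<bar>h \<bullet> g z - h \<bullet> g x0\<bar> \<le> \<epsilon> * norm h" for h
        using Cauchy_Schwarz_ineq2[of h "g z - g x0"] mult_left_mono[of "norm (g z - g x0)" \<epsilon> "norm h"]
        by (simp add: inner_diff_right mult.commute)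
      then show "onorm ((\<lambda>h. h \<bullet> g z) - (\<lambda>h. h \<bullet> g x0)) \<le> \<epsilon>"
        by (intro onorm_le) auto
    qed
    then show "\<bar>f x - f y - g x0 \<bullet> (x - y)\<bar> \<le> \<epsilon> * norm (x - y)" by (simp add: inner_commute mult.commute)
  qed
qed

text \<open>The map \<open>\<Psi>\<close> applies \<open>T\<close> to the base point and rescales the fibre to the constant radius \<open>f x0\<close>. It
sends the array over \<open>E\<close> onto \<open>T ` E \<times> sphere 0 (f x0)\<close>. Near \<open>x0\<close>, the radial part of the squared
distance, \<open>|h|\<^sup>2 + (f x - f y)\<^sup>2\<close>, is close to \<open>|T h|\<^sup>2\<close>, and the product of the radii is close to
\<open>(f x0)\<^sup>2\<close>, in each case up to the factor \<open>L\<^sup>2\<close>.\<close>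

lemma vol_array_local:
  fixes f :: "real ^ 'm \<Rightarrow> real"
  assumes dim: "DIM('j::euclidean_space) + 1 = DIM('b::euclidean_space)"
    and \<Omega>: "open \<Omega>" "x0 \<in> \<Omega>" and L: "1 < L"
    and cont: "continuous_on \<Omega> g" and der: "\<And>x. x \<in> \<Omega> \<Longrightarrow> GDERIV f x :> g x"
    and pos: "0 < f x0" and J: "J = f x0 ^ DIM('j) * sqrt (1 + (norm (g x0))\<^sup>2)"
  obtains \<rho> where "0 < \<rho>" "ball x0 \<rho> \<subseteq> \<Omega>"
    "\<And>E. E \<in> sets borel \<Longrightarrow> E \<subseteq> ball x0 \<rho> \<Longrightarrow>
       vol DIM((real ^ 'm) \<times> 'j) (spherical_array E f :: ((real ^ 'm) \<times> 'b) set)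
         \<le> ennreal (L ^ DIM((real ^ 'm) \<times> 'j)) * (ennreal J * emeasure lborel E * vol DIM('j) (sphere (0::'b) 1))"
    "\<And>E. E \<in> sets borel \<Longrightarrow> E \<subseteq> ball x0 \<rho> \<Longrightarrow>
       ennreal J * emeasure lborel E * vol DIM('j) (sphere (0::'b) 1)
         \<le> ennreal (L ^ DIM((real ^ 'm) \<times> 'j)) * 
            vol DIM((real ^ 'm) \<times> 'j) (spherical_array E f :: ((real ^ 'm) \<times> 'b) set)"
proof -
  define r where "r = f x0"
  have r: "0 < r" using pos by (simp add: r_def)
  \<comment> \<open>The first bound is for the error of the gradient; the second keeps \<open>f\<close> between \<open>r / L\<close> and \<open>r * L\<close>.\<close>
  define \<epsilon> where "\<epsilon> = min (L - 1) (r * (1 - 1 / L))"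
  have rL: "r * (1 - 1 / L) \<le> r * (L - 1)"
  proof -
    have "1 - 1 / L = (L - 1) / L" using L by (simp add: field_simps)
    also have "\<dots> \<le> L - 1" using L by (simp add: divide_le_eq mult_le_cancel_left1)
    finally show ?thesis using r by simp
  qed
  have "1 / L < 1" using L by simp
  then have "0 < r * (1 - 1 / L)" using r by simp
  then have \<epsilon>: "0 < \<epsilon>" "\<epsilon> \<le> L - 1" "\<epsilon> \<le> r - r / L" "\<epsilon> \<le> r * L - r"
    using L rL by (auto simp: \<epsilon>_def right_diff_distrib)
  obtain \<rho> where \<rho>: "0 < \<rho>" "ball x0 \<rho> \<subseteq> \<Omega>"
    and lin: "\<And>x y. x \<in> ball x0 \<rho> \<Longrightarrow> y \<in> ball x0 \<rho> \<Longrightarrow> \<bar>f x - f y - g x0 \<bullet> (x - y)\<bar> \<le> \<epsilon> * norm (x - y)"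
    and near: "\<And>x. x \<in> ball x0 \<rho> \<Longrightarrow> \<bar>f x - f x0\<bar> \<le> \<epsilon>"
    by (rule locally_linear_of_continuous_gradient[OF \<Omega> \<epsilon>(1) cont der]) (assumption, rule that, simp_all)
  obtain T :: "real ^ 'm \<Rightarrow> real ^ 'm" where T: "linear T"
    "\<And>x. (norm (T x))\<^sup>2 = (norm x)\<^sup>2 + (g x0 \<bullet> x)\<^sup>2"
    "\<And>E. E \<in> sets borel \<Longrightarrow> T ` E \<in> sets borel"
    "\<And>E. E \<in> sets borel \<Longrightarrow> emeasure lborel (T ` E) = ennreal (sqrt (1 + (norm (g x0))\<^sup>2)) * emeasure lborel E"
    by (rule stretch_map_exists) (rule that; simp)
  define \<Psi> where "\<Psi> z = (T (fst z), (r / f (fst z)) *\<^sub>R snd z)" for z :: "(real ^ 'm) \<times> 'b"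
  have bounds: "r / L \<le> f x" "f x \<le> r * L" "0 < f x" if "x \<in> ball x0 \<rho>" for x
  proof -
    show 1: "r / L \<le> f x" "f x \<le> r * L" using near[OF that] \<epsilon> by (auto simp: r_def abs_le_iff)
    have "0 < r / L" using r L by simp
    with 1 show "0 < f x" by linarith
  qed
  have key: "(dist z w)\<^sup>2 \<le> L\<^sup>2 * (dist (\<Psi> z) (\<Psi> w))\<^sup>2 \<and> (dist (\<Psi> z) (\<Psi> w))\<^sup>2 \<le> L\<^sup>2 * (dist z w)\<^sup>2"
    if z: "fst z \<in> ball x0 \<rho>" "norm (snd z) = f (fst z)"
      and w: "fst w \<in> ball x0 \<rho>" "norm (snd w) = f (fst w)" for z w :: "(real ^ 'm) \<times> 'b"
  proof -
    define h where "h = fst z - fst w"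
    define N where "N = (norm ((1 / f (fst z)) *\<^sub>R snd z - (1 / f (fst w)) *\<^sub>R snd w))\<^sup>2"
    note bz = bounds[OF z(1)] and bw = bounds[OF w(1)]
    have 1: "(dist z w)\<^sup>2 = ((norm h)\<^sup>2 + (f (fst z) - f (fst w))\<^sup>2) + f (fst z) * f (fst w) * N"
      using norm_diff_polar[OF z(2) w(2) bz(3) bw(3)]
      by (simp add: dist_prod_squared h_def N_def)
    have "(r / f (fst z)) *\<^sub>R snd z - (r / f (fst w)) *\<^sub>R snd w
        = r *\<^sub>R ((1 / f (fst z)) *\<^sub>R snd z - (1 / f (fst w)) *\<^sub>R snd w)"
      by (simp add: scaleR_diff_right)
    then have 2: "(dist (\<Psi> z) (\<Psi> w))\<^sup>2 = ((norm h)\<^sup>2 + (g x0 \<bullet> h)\<^sup>2) + r\<^sup>2 * N"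
      unfolding \<Psi>_def dist_prod_squared
      by (simp add: h_def N_def T(2) power_mult_distrib flip: linear_diff[OF T(1)])
    have lin': "\<bar>(f (fst z) - f (fst w)) - g x0 \<bullet> h\<bar> \<le> (L - 1) * \<bar>norm h\<bar>"
      using lin[OF z(1) w(1)] mult_right_mono[OF \<epsilon>(2) norm_ge_zero, of h] by (simp add: h_def)
    have A: "(norm h)\<^sup>2 + (f (fst z) - f (fst w))\<^sup>2 \<le> L\<^sup>2 * ((norm h)\<^sup>2 + (g x0 \<bullet> h)\<^sup>2)"
      using sum_squares_perturb[OF lin'] L by simp
    have B: "(norm h)\<^sup>2 + (g x0 \<bullet> h)\<^sup>2 \<le> L\<^sup>2 * ((norm h)\<^sup>2 + (f (fst z) - f (fst w))\<^sup>2)"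
      using sum_squares_perturb[of "g x0 \<bullet> h" "f (fst z) - f (fst w)" "L - 1" "norm h"] lin' L
      by (simp add: abs_minus_commute)
    have "f (fst z) * f (fst w) \<le> (r * L) * (r * L)"
      using bz bw r L by (intro mult_mono) auto
    then have C: "f (fst z) * f (fst w) \<le> L\<^sup>2 * r\<^sup>2" by (simp add: power2_eq_square ac_simps)
    have "(r / L) * (r / L) \<le> f (fst z) * f (fst w)"
      using bz bw r L by (intro mult_mono) auto
    then have D: "r\<^sup>2 \<le> L\<^sup>2 * (f (fst z) * f (fst w))"
      using L by (simp add: power2_eq_square field_simps)
    have N: "0 \<le> N" by (simp add: N_def)
    show ?thesis unfolding 1 2
      using A B mult_right_mono[OF C N] mult_right_mono[OF D N] by (simp add: distrib_left mult.assoc)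
  qed
  have key': "dist z w \<le> L * dist (\<Psi> z) (\<Psi> w)" "dist (\<Psi> z) (\<Psi> w) \<le> L * dist z w"
    if "z \<in> spherical_array E f" "w \<in> spherical_array E f" and E: "E \<subseteq> ball x0 \<rho>" for z w and E
  proof -
    have *: "fst z \<in> ball x0 \<rho>" "norm (snd z) = f (fst z)"
      if "z \<in> spherical_array E f" for z :: "(real ^ 'm) \<times> 'b"
    proof -
      show 1: "fst z \<in> ball x0 \<rho>" using that E by (auto simp: spherical_array_def)
      then show "norm (snd z) = f (fst z)"
        using that bounds(3)[OF 1] by (auto simp: spherical_array_def power2_eq_iff_nonneg)
    qed
    note k = key[OF *[OF that(1)] *[OF that(2)]]
    show "dist z w \<le> L * dist (\<Psi> z) (\<Psi> w)"
      by (rule power2_le_imp_le) (use k L in \<open>auto simp: power_mult_distrib\<close>)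
    show "dist (\<Psi> z) (\<Psi> w) \<le> L * dist z w"
      by (rule power2_le_imp_le) (use k L in \<open>auto simp: power_mult_distrib\<close>)
  qed
  have img: "\<Psi> ` spherical_array E f = T ` E \<times> sphere 0 r" if E: "E \<subseteq> ball x0 \<rho>" for E
  proof (intro subset_antisym subsetI)
    fix u assume "u \<in> \<Psi> ` spherical_array E f"
    then obtain x y where xy: "x \<in> E" "(norm y)\<^sup>2 = (f x)\<^sup>2" "u = \<Psi> (x, y)"
      by (auto simp: spherical_array_def)
    moreover have "0 < f x" using xy(1) E bounds by blast
    ultimately have "norm y = f x" by (simp add: power2_eq_iff_nonneg)
    then show "u \<in> T ` E \<times> sphere 0 r" using xy r \<open>0 < f x\<close> by (auto simp: \<Psi>_def)
  next
    fix u assume "u \<in> T ` E \<times> sphere (0::'b) r"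
    then obtain x v where xv: "x \<in> E" "u = (T x, v)" "norm v = r" by auto
    have "0 < f x" using xv(1) E bounds by blast
    then have "(x, (f x / r) *\<^sub>R v) \<in> spherical_array E f" "\<Psi> (x, (f x / r) *\<^sub>R v) = u"
      using xv r by (auto simp: spherical_array_def \<Psi>_def)
    then show "u \<in> \<Psi> ` spherical_array E f" by (metis imageI)
  qed
  have volimg: "vol DIM((real ^ 'm) \<times> 'j) (\<Psi> ` spherical_array E f)
      = ennreal J * emeasure lborel E * vol DIM('j) (sphere (0::'b) 1)"
    if "E \<in> sets borel" "E \<subseteq> ball x0 \<rho>" for E
    unfolding img[OF that(2)] vol_Times_scaled_sphere[OF dim T(3)[OF that(1)] r] T(4)[OF that(1)]
    using r by (simp add: J r_def ennreal_mult mult.assoc)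
  have d: "DIM((real ^ 'm) \<times> 'j) \<le> DIM((real ^ 'm) \<times> 'b)" using dim by simp
  show thesis
  proof (rule that[OF \<rho>])
    fix E :: "(real ^ 'm) set" assume E: "E \<in> sets borel" "E \<subseteq> ball x0 \<rho>"
    have L0: "0 < L" using L by simp
    show "vol DIM((real ^ 'm) \<times> 'j) (spherical_array E f :: ((real ^ 'm) \<times> 'b) set)
         \<le> ennreal (L ^ DIM((real ^ 'm) \<times> 'j)) * (ennreal J * emeasure lborel E * vol DIM('j) (sphere (0::'b) 1))"
      unfolding volimg[OF E, symmetric] by (rule vol_le_of_expanding[OF key'(1)[OF _ _ E(2)] L0 d d])
    show "ennreal J * emeasure lborel E * vol DIM('j) (sphere (0::'b) 1)
         \<le> ennreal (L ^ DIM((real ^ 'm) \<times> 'j)) * 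
            vol DIM((real ^ 'm) \<times> 'j) (spherical_array E f :: ((real ^ 'm) \<times> 'b) set)"
      unfolding volimg[OF E, symmetric] by (rule vol_lipschitz[OF key'(2)[OF _ _ E(2)] L0 d d])
  qed
qed

section \<open>The projection property and the volume density\<close>

lemma spherical_array_UN:
  "spherical_array (\<Union>i\<in>I. U i) f = (\<Union>i\<in>I. spherical_array (U i) f)"
  by (auto simp: spherical_array_def)

lemma spherical_array_mono: "U \<subseteq> W \<Longrightarrow> spherical_array U f \<subseteq> spherical_array W f"
  by (auto simp: spherical_array_def)

lemma fst_spherical_array:
  "fst ` (spherical_array U f :: ('a::euclidean_space \<times> 'b::euclidean_space) set) = U"
proof (intro subset_antisym subsetI)
  fix x assume x: "x \<in> U"
  obtain y :: 'b where "norm y = \<bar>f x\<bar>" using vector_choose_size[of "\<bar>f x\<bar>"] by auto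
  then have "(x, y) \<in> spherical_array U f" using x by (simp add: spherical_array_def)
  then show "x \<in> fst ` (spherical_array U f :: ('a \<times> 'b) set)" by force
qed (auto simp: spherical_array_def)

lemma spherical_array_over:
  "W \<subseteq> U \<Longrightarrow> spherical_array U f \<inter> fst -` W = spherical_array W f"
  by (auto simp: spherical_array_def)

text \<open>Over the open set \<open>\<Omega>\<close>, where \<open>f\<close> is continuous, the array is relatively closed.\<close>

lemma borel_spherical_array:
  fixes f :: "'a::euclidean_space \<Rightarrow> real"
  assumes \<Omega>: "open \<Omega>" and f: "continuous_on \<Omega> f" and U: "U \<in> sets borel" "U \<subseteq> \<Omega>"
  shows "(spherical_array U f :: ('a \<times> 'b::euclidean_space) set) \<in> sets borel"
proof -
  let ?h = "\<lambda>z :: 'a \<times> 'b. (norm (snd z))\<^sup>2 - (f (fst z))\<^sup>2"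
  have "continuous_on (\<Omega> \<times> UNIV) ?h"
    by (intro continuous_intros continuous_on_compose2[OF f]) auto
  then have "closedin (top_of_set (\<Omega> \<times> UNIV)) {z \<in> \<Omega> \<times> UNIV. ?h z = 0}"
    by (rule continuous_closedin_preimage_constant)
  then obtain T where T: "closed T" "{z \<in> \<Omega> \<times> UNIV. ?h z = 0} = (\<Omega> \<times> UNIV) \<inter> T"
    by (auto simp: closedin_closed)
  have "spherical_array U f = (U \<times> UNIV) \<inter> {z \<in> \<Omega> \<times> UNIV. ?h z = 0}"
    using U(2) by (auto simp: spherical_array_def)
  also have "\<dots> = (U \<times> UNIV) \<inter> ((\<Omega> \<times> UNIV) \<inter> T)" by (simp only: T(2))
  also have "\<dots> \<in> sets borel"
    using U(1) \<Omega> T(1) by (intro sets.Int borel_Times) (auto intro: borel_open borel_closed)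
  finally show ?thesis .
qed

lemma volume_density_eq_1:
  fixes f :: "real ^ 'm \<Rightarrow> real"
  assumes dim: "DIM('j::euclidean_space) + 1 = DIM('b::euclidean_space)"
    and \<Omega>: "open \<Omega>" "x0 \<in> \<Omega>"
    and cont: "continuous_on \<Omega> g" and der: "\<And>x. x \<in> \<Omega> \<Longrightarrow> GDERIV f x :> g x"
    and pos: "0 < f x0"
    and vol: "\<And>E. E \<in> sets borel \<Longrightarrow> E \<subseteq> \<Omega> \<Longrightarrow>
      vol DIM((real ^ 'm) \<times> 'j) (spherical_array E f :: ((real ^ 'm) \<times> 'b) set)
        = vol DIM('j) (sphere (0::'b) 1) * emeasure lborel E"
  shows "f x0 ^ DIM('j) * sqrt (1 + (norm (g x0))\<^sup>2) = 1"
proof -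
  let ?V = "vol DIM('j) (sphere (0::'b) 1)"
  let ?d = "DIM((real ^ 'm) \<times> 'j)"
  define J where "J = f x0 ^ DIM('j) * sqrt (1 + (norm (g x0))\<^sup>2)"
  have both: "ennreal J \<le> ennreal (L ^ ?d) * 1 \<and> 1 \<le> ennreal (L ^ ?d) * ennreal J" if L: "1 < L" for L
  proof -
    obtain \<rho> where \<rho>: "0 < \<rho>" "ball x0 \<rho> \<subseteq> \<Omega>"
      and up: "\<And>E. E \<in> sets borel \<Longrightarrow> E \<subseteq> ball x0 \<rho> \<Longrightarrow>
         vol ?d (spherical_array E f :: ((real ^ 'm) \<times> 'b) set) \<le> ennreal (L ^ ?d) * (ennreal J * emeasure lborel E * ?V)"
      and lo: "\<And>E. E \<in> sets borel \<Longrightarrow> E \<subseteq> ball x0 \<rho> \<Longrightarrow>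
         ennreal J * emeasure lborel E * ?V \<le> ennreal (L ^ ?d) * vol ?d (spherical_array E f :: ((real ^ 'm) \<times> 'b) set)"
      by (rule vol_array_local[OF dim \<Omega> L cont der pos J_def]) (assumption, rule that, simp_all)
    define c where "c = emeasure lborel (ball x0 \<rho>) * ?V"
    have "0 < emeasure lborel (ball x0 \<rho>)" using \<rho>(1) by (simp add: emeasure_ball)
    then have c0: "c \<noteq> 0" using vol_sphere_pos[OF dim] by (auto simp: c_def)
    have "emeasure lborel (ball x0 \<rho>) < top" using emeasure_bounded_finite[OF bounded_ball, of x0 \<rho>] by simp
    then have c1: "c \<noteq> top" using vol_sphere_finite[OF dim] by (auto simp: c_def ennreal_mult_eq_top_iff)
    have v: "vol ?d (spherical_array (ball x0 \<rho>) f :: ((real ^ 'm) \<times> 'b) set) = c"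
      using vol[OF _ \<rho>(2)] by (simp add: c_def mult.commute)
    have "c * 1 \<le> c * (ennreal (L ^ ?d) * ennreal J)"
      using up[of "ball x0 \<rho>"] unfolding v by (simp add: c_def ac_simps)
    moreover have "c * ennreal J \<le> c * (ennreal (L ^ ?d) * 1)"
      using lo[of "ball x0 \<rho>"] unfolding v by (simp add: c_def ac_simps)
    ultimately show ?thesis unfolding ennreal_mult_le_mult_iff[OF c0 c1] by simp
  qed
  have "ennreal J \<le> 1" by (rule ennreal_le_of_le_power_mult[of _ ?d]) (use both in blast)
  moreover have "1 \<le> ennreal J" by (rule ennreal_le_of_le_power_mult[of _ ?d]) (use both in blast)
  ultimately have "ennreal J = 1" by (rule antisym)
  then show ?thesis by (simp add: J_def)
qed

lemma countable_ball_cover: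
  fixes \<Omega> :: "'a::euclidean_space set"
  assumes "\<Omega> \<noteq> {}" and \<rho>: "\<And>x. x \<in> \<Omega> \<Longrightarrow> 0 < \<rho> x"
  obtains c :: "nat \<Rightarrow> 'a" where "\<And>i. c i \<in> \<Omega>" "\<Omega> \<subseteq> (\<Union>i. ball (c i) (\<rho> (c i)))"
proof -
  obtain F where F: "F \<subseteq> (\<lambda>x. ball x (\<rho> x)) ` \<Omega>" "countable F" "\<Union>F = (\<Union>x\<in>\<Omega>. ball x (\<rho> x))"
    by (rule Lindelof[of "(\<lambda>x. ball x (\<rho> x)) ` \<Omega>"]) auto
  from F(1,2) obtain C where C: "C \<subseteq> \<Omega>" "countable C" "F = (\<lambda>x. ball x (\<rho> x)) ` C"
    using countable_subset_image[of F "\<lambda>x. ball x (\<rho> x)" \<Omega>] by auto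
  have cover: "\<Omega> \<subseteq> (\<Union>x\<in>C. ball x (\<rho> x))"
  proof -
    have "\<Omega> \<subseteq> (\<Union>x\<in>\<Omega>. ball x (\<rho> x))" using \<rho> by force
    then show ?thesis using F(3) C(3) by simp
  qed
  then have "C \<noteq> {}" using assms(1) by auto
  then have C_eq: "C = range (from_nat_into C)" using C(2) by (simp add: range_from_nat_into)
  show thesis
  proof (rule that)
    show "from_nat_into C i \<in> \<Omega>" for i using C(1) C_eq by blast
    show "\<Omega> \<subseteq> (\<Union>i. ball (from_nat_into C i) (\<rho> (from_nat_into C i)))"
      using cover by (subst (asm) C_eq) blast
  qed
qed

text \<open>For Borel sets the local estimates are added up over a countable partition into subsets of small
balls. A Lebesgue measurable set is squeezed between two Borel sets of the same measure.\<close>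

lemma vol_array_of_density_1:
  fixes f :: "real ^ 'm \<Rightarrow> real"
  assumes dim: "DIM('j::euclidean_space) + 1 = DIM('b::euclidean_space)"
    and \<Omega>: "open \<Omega>"
    and cont: "continuous_on \<Omega> g" and der: "\<And>x. x \<in> \<Omega> \<Longrightarrow> GDERIV f x :> g x"
    and pos: "\<And>x. x \<in> \<Omega> \<Longrightarrow> 0 < f x"
    and J: "\<And>x. x \<in> \<Omega> \<Longrightarrow> f x ^ DIM('j) * sqrt (1 + (norm (g x))\<^sup>2) = 1"
    and U: "U \<in> sets lebesgue" "U \<subseteq> \<Omega>"
  shows "vol DIM((real ^ 'm) \<times> 'j) (spherical_array U f :: ((real ^ 'm) \<times> 'b) set)
        = vol DIM('j) (sphere (0::'b) 1) * emeasure lebesgue U"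
proof -
  let ?V = "vol DIM('j) (sphere (0::'b) 1)"
  let ?d = "DIM((real ^ 'm) \<times> 'j)"
  let ?A = "\<lambda>E. spherical_array E f :: ((real ^ 'm) \<times> 'b) set"
  have fcont: "continuous_on \<Omega> f"
    using der unfolding gderiv_def by (meson continuous_at_imp_continuous_on has_derivative_continuous)
  have borel: "vol ?d (?A E) = ?V * emeasure lborel E" if E: "E \<in> sets borel" "E \<subseteq> \<Omega>" for E
  proof (cases "\<Omega> = {}")
    case True
    with E have "E = {}" by blast
    then show ?thesis using vol_eq_lborel[of "{} :: (real ^ 'm) set"] by (simp add: spherical_array_def vol_def)
  next
    case False
    have both: "vol ?d (?A E) \<le> ennreal (L ^ ?d) * (?V * emeasure lborel E) \<and>
        ?V * emeasure lborel E \<le> ennreal (L ^ ?d) * vol ?d (?A E)" if L: "1 < L" for L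
    proof -
      define good where "good x \<rho> \<longleftrightarrow> 0 < \<rho> \<and> (\<forall>E \<in> sets borel. E \<subseteq> ball x \<rho> \<longrightarrow>
          vol ?d (?A E) \<le> ennreal (L ^ ?d) * (?V * emeasure lborel E) \<and>
          ?V * emeasure lborel E \<le> ennreal (L ^ ?d) * vol ?d (?A E))" for x \<rho>
      have "\<exists>\<rho>. good x \<rho>" if x: "x \<in> \<Omega>" for x
      proof -
        obtain \<rho> where "0 < \<rho>" "ball x \<rho> \<subseteq> \<Omega>"
          and "\<And>E. E \<in> sets borel \<Longrightarrow> E \<subseteq> ball x \<rho> \<Longrightarrow>
             vol ?d (?A E) \<le> ennreal (L ^ ?d) * (ennreal 1 * emeasure lborel E * ?V)"
          and "\<And>E. E \<in> sets borel \<Longrightarrow> E \<subseteq> ball x \<rho> \<Longrightarrow>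
             ennreal 1 * emeasure lborel E * ?V \<le> ennreal (L ^ ?d) * vol ?d (?A E)"
          by (rule vol_array_local[OF dim \<Omega> x L cont der pos[OF x] J[OF x, symmetric]]) (assumption, rule that, simp_all)
        then have "good x \<rho>" by (simp add: good_def mult.commute)
        then show ?thesis ..
      qed
      then obtain \<rho> where \<rho>: "\<And>x. x \<in> \<Omega> \<Longrightarrow> good x (\<rho> x)" by metis
      then obtain c :: "nat \<Rightarrow> real ^ 'm" where c: "\<And>i. c i \<in> \<Omega>" "\<Omega> \<subseteq> (\<Union>i. ball (c i) (\<rho> (c i)))"
        using countable_ball_cover[OF False, of \<rho>] unfolding good_def by metis
      define P where "P i = E \<inter> disjointed (\<lambda>i. ball (c i) (\<rho> (c i))) i" for i
      have Pb: "P i \<in> sets borel" for i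
        unfolding P_def disjointed_def using E by (intro sets.Int sets.Diff sets.finite_UN) auto
      have PE: "(\<Union>i. P i) = E"
        using c(2) E(2) by (auto simp: P_def UN_disjointed_eq simp flip: Int_UN_distrib)
      have disj: "disjoint_family P"
        unfolding P_def using disjoint_family_disjointed[of "\<lambda>i. ball (c i) (\<rho> (c i))"]
        by (auto simp: disjoint_family_on_def)
      have Pball: "P i \<subseteq> ball (c i) (\<rho> (c i))" for i
        using disjointed_subset[of "\<lambda>i. ball (c i) (\<rho> (c i))" i] by (auto simp: P_def)
      have Pi: "vol ?d (?A (P i)) \<le> ennreal (L ^ ?d) * (?V * emeasure lborel (P i))"
          "?V * emeasure lborel (P i) \<le> ennreal (L ^ ?d) * vol ?d (?A (P i))" for i
        using \<rho>[OF c(1)[of i]] Pb[of i] Pball[of i] unfolding good_def by blast+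
      have "?A E = (\<Union>i. ?A (P i))" using PE spherical_array_UN[of P UNIV f] by simp
      moreover have "vol ?d (\<Union>i. ?A (P i)) = (\<Sum>i. vol ?d (?A (P i)))"
      proof (rule vol_suminf)
        show "disjoint_family (\<lambda>i. ?A (P i))"
          using disj by (auto simp: disjoint_family_on_def spherical_array_def)
        show "?A (P i) \<in> sets borel" for i
          using Pb[of i] E(2) PE by (intro borel_spherical_array[OF \<Omega> fcont]) auto
      qed
      ultimately have vA: "vol ?d (?A E) = (\<Sum>i. vol ?d (?A (P i)))" by simp
      have vE: "emeasure lborel E = (\<Sum>i. emeasure lborel (P i))"
        using suminf_emeasure[of P lborel] disj Pb by (simp add: PE image_subset_iff)
      show ?thesis
        unfolding vA vE ennreal_suminf_cmult[symmetric]
        by (intro conjI suminf_le Pi) auto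
    qed
    show ?thesis
      by (intro antisym; rule ennreal_le_of_le_power_mult[of _ ?d]) (use both in blast)+
  qed
  obtain S N N' where SN: "U = S \<union> N" "N \<subseteq> N'" "N' \<in> null_sets lborel" "S \<in> sets lborel"
    using U(1) by (rule sets_completionE)
  \<comment> \<open>Cutting with \<open>\<Omega>\<close> keeps the larger Borel set inside the domain of the estimate.\<close>
  define W where "W = S \<union> (N' \<inter> \<Omega>)"
  have SW: "S \<in> sets borel" "W \<in> sets borel" "S \<subseteq> U" "U \<subseteq> W" "W \<subseteq> \<Omega>"
    using SN U(2) \<Omega> by (auto simp: W_def)
  have "N' \<inter> \<Omega> \<in> null_sets lborel"
    using SN(3) \<Omega> by (intro null_set_Int2) auto
  then have WS: "emeasure lborel W = emeasure lborel S"
    unfolding W_def using SN(4) by (rule emeasure_Un_null_set[rotated])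
  have leb: "emeasure lebesgue S = emeasure lborel S" "emeasure lebesgue W = emeasure lborel S"
    using SW(1,2) WS by simp_all
  have "emeasure lebesgue S \<le> emeasure lebesgue U" by (rule emeasure_mono[OF SW(3) U(1)])
  moreover have "emeasure lebesgue U \<le> emeasure lebesgue W"
    by (rule emeasure_mono[OF SW(4)]) (use SW(2) in simp)
  ultimately have US: "emeasure lebesgue U = emeasure lborel S"
    unfolding leb by (intro antisym)
  show ?thesis
  proof (rule antisym)
    have "vol ?d (?A U) \<le> vol ?d (?A W)" by (intro vol_mono spherical_array_mono SW)
    also have "\<dots> = ?V * emeasure lebesgue U" unfolding borel[OF SW(2,5)] WS US ..
    finally show "vol ?d (?A U) \<le> ?V * emeasure lebesgue U" .
    have "?V * emeasure lebesgue U = vol ?d (?A S)"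
      unfolding US using borel[OF SW(1)] SW(3) U(2) by (metis subset_trans)
    also have "\<dots> \<le> vol ?d (?A U)" by (intro vol_mono spherical_array_mono SW)
    finally show "?V * emeasure lebesgue U \<le> vol ?d (?A U)" .
  qed
qed

section \<open>The Archimedean scaling function\<close>

text \<open>On the unit interval \<open>t\<^sup>2\<^sup>k\<^sup>-\<^sup>2 \<le> t\<close>, so the integrand is at most \<open>1 / sqrt (1 - t)\<close>, which has the
primitive \<open>- 2 * sqrt (1 - t)\<close>. At \<open>t = 1\<close> both functions have the value 0, by division by zero.\<close>

lemma arch_integrand_integrable:
  assumes k: "2 \<le> k"
  shows "(\<lambda>t::real. t ^ (k - 1) / sqrt (1 - t ^ (2 * k - 2))) integrable_on {0..1}"
proof (rule measurable_bounded_by_integrable_imp_integrable)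
  have "((\<lambda>t. 1 / sqrt (1 - t)) has_integral (- 2 * sqrt (1 - 1) - (- 2 * sqrt (1 - 0)))) {0..1::real}"
  proof (rule fundamental_theorem_of_calculus_interior)
    show "continuous_on {0..1::real} (\<lambda>t. - 2 * sqrt (1 - t))" by (intro continuous_intros)
    fix x :: real assume "x \<in> {0<..<1}"
    then show "((\<lambda>t. - 2 * sqrt (1 - t)) has_vector_derivative 1 / sqrt (1 - x)) (at x)"
      unfolding has_real_derivative_iff_has_vector_derivative[symmetric]
      by (auto intro!: derivative_eq_intros simp: field_simps)
  qed simp
  then show "(\<lambda>t. 1 / sqrt (1 - t)) integrable_on {0..1::real}" by blast
  show "(\<lambda>t::real. t ^ (k - 1) / sqrt (1 - t ^ (2 * k - 2))) \<in> borel_measurable (lebesgue_on {0..1})"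
    by (intro measurable_restrict_space1 measurable_completion) simp
  fix t :: real assume t: "t \<in> {0..1}"
  show "norm (t ^ (k - 1) / sqrt (1 - t ^ (2 * k - 2))) \<le> 1 / sqrt (1 - t)"
  proof (cases "t = 1")
    case False
    have "t ^ (2 * k - 2) \<le> t ^ 1" using t k by (intro power_decreasing) auto
    then have "sqrt (1 - t) \<le> sqrt (1 - t ^ (2 * k - 2))" "0 < sqrt (1 - t)" using t False by auto
    moreover have "t ^ (k - 1) \<le> 1" using t by (intro power_le_one) auto
    ultimately show ?thesis using t by (simp add: frac_le)
  qed simp
qed auto

lemma arch_integrand_pos:
  fixes y :: real
  assumes "2 \<le> k" "0 < y" "y < 1"
  shows "0 < sqrt (1 - y ^ (2 * k - 2))" "0 < y ^ (k - 1) / sqrt (1 - y ^ (2 * k - 2))"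
proof -
  have "y ^ (2 * k - 2) \<le> y ^ 1" using assms by (intro power_decreasing) auto
  then show "0 < sqrt (1 - y ^ (2 * k - 2))" using assms by simp
  then show "0 < y ^ (k - 1) / sqrt (1 - y ^ (2 * k - 2))" using assms by simp
qed

lemma arch_scale_inv_continuous:
  assumes "2 \<le> k"
  shows "continuous_on {0..1} (arch_scale_inv k)"
  unfolding arch_scale_inv_def[abs_def]
  by (rule indefinite_integral_continuous_1[OF arch_integrand_integrable[OF assms]])

lemma arch_scale_inv_DERIV:
  assumes k: "2 \<le> k" and y: "0 < y" "y < 1"
  shows "DERIV (arch_scale_inv k) y :> y ^ (k - 1) / sqrt (1 - y ^ (2 * k - 2))"
proof -
  have "isCont (\<lambda>t::real. t ^ (k - 1) / sqrt (1 - t ^ (2 * k - 2))) y"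
    using arch_integrand_pos(1)[OF k y] by (intro continuous_intros) auto
  then have "((\<lambda>u. integral {0..u} (\<lambda>t. t ^ (k - 1) / sqrt (1 - t ^ (2 * k - 2)))) has_vector_derivative
      y ^ (k - 1) / sqrt (1 - y ^ (2 * k - 2))) (at y within {0..1} - {})"
    using y by (intro integral_has_vector_derivative_continuous_at arch_integrand_integrable[OF k])
      (auto intro: continuous_at_imp_continuous_within)
  then show ?thesis
    using y by (simp add: at_within_Icc_at has_real_derivative_iff_has_vector_derivative arch_scale_inv_def[abs_def])
qed

lemma arch_scale_inv_less:
  assumes k: "2 \<le> k" and y: "0 \<le> a" "a < b" "b \<le> 1"
  shows "arch_scale_inv k a < arch_scale_inv k b"
proof (rule DERIV_pos_imp_increasing_open[OF y(2)])
  show "continuous_on {a..b} (arch_scale_inv k)"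
    using y by (intro continuous_on_subset[OF arch_scale_inv_continuous[OF k]]) auto
  fix x assume "a < x" "x < b"
  then have "0 < x" "x < 1" using y by auto
  then show "\<exists>D. DERIV (arch_scale_inv k) x :> D \<and> 0 < D"
    using arch_scale_inv_DERIV[OF k] arch_integrand_pos(2)[OF k] by blast
qed

lemma arch_scale_inv_0 [simp]: "arch_scale_inv k 0 = 0"
  by (simp add: arch_scale_inv_def)

lemma arch_scale_inv_1: "arch_scale_inv k 1 = arch_M k"
  by (simp add: arch_scale_inv_def arch_M_def)

lemma arch_scale_arch_scale_inv:
  assumes k: "2 \<le> k" and y: "0 \<le> y" "y \<le> 1"
  shows "arch_scale k (arch_scale_inv k y) = y"
proof -
  have "inj_on (arch_scale_inv k) {0..1}"
    by (rule linorder_inj_onI) (use arch_scale_inv_less[OF k] in force)+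
  then show ?thesis unfolding arch_scale_def using y by (intro the_inv_into_f_f) auto
qed

lemma arch_scale_inv_onto:
  assumes k: "2 \<le> k" and w: "0 < w" "w < arch_M k"
  obtains y where "0 < y" "y < 1" "arch_scale_inv k y = w"
proof -
  obtain y where y: "0 \<le> y" "y \<le> 1" "arch_scale_inv k y = w"
    using IVT'[of "arch_scale_inv k" 0 w 1] arch_scale_inv_continuous[OF k] w by (auto simp: arch_scale_inv_1)
  then have "y \<noteq> 0" "y \<noteq> 1" using w by (auto simp: arch_scale_inv_1)
  then show thesis using y by (intro that[of y]) auto
qed

lemma arch_scale_bounds:
  assumes k: "2 \<le> k" and w: "0 < w" "w < arch_M k"
  shows "0 < arch_scale k w" "arch_scale k w < 1" "arch_scale_inv k (arch_scale k w) = w"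
proof -
  obtain y where y: "0 < y" "y < 1" "arch_scale_inv k y = w" by (rule arch_scale_inv_onto[OF k w])
  then have "arch_scale k w = y" using arch_scale_arch_scale_inv[OF k, of y] by simp
  with y show "0 < arch_scale k w" "arch_scale k w < 1" "arch_scale_inv k (arch_scale k w) = w" by auto
qed

lemma arch_scale_DERIV:
  assumes k: "2 \<le> k" and w: "0 < w" "w < arch_M k"
  shows "DERIV (arch_scale k) w :> sqrt (1 - arch_scale k w ^ (2 * k - 2)) / arch_scale k w ^ (k - 1)"
proof -
  define y where "y = arch_scale k w"
  note y = arch_scale_bounds[OF k w, folded y_def]
  have "isCont (arch_scale k) (arch_scale_inv k y)"
  \<comment> \<open>The interval contains \<open>y\<close> in its interior and stays away from 0 and 1.\<close>
  proof (rule isCont_inverse_function2[where f = "arch_scale_inv k" and a = "y / 2" and b = "(1 + y) / 2"])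
    fix z assume z: "y / 2 \<le> z" "z \<le> (1 + y) / 2"
    then have "0 < z" "z < 1" using y by auto
    then show "arch_scale k (arch_scale_inv k z) = z" "isCont (arch_scale_inv k) z"
      using arch_scale_arch_scale_inv[OF k] DERIV_isCont[OF arch_scale_inv_DERIV[OF k]] by auto
  qed (use y in auto)
  then have "isCont (arch_scale k) w" by (simp only: y(3))
  have "DERIV (arch_scale k) w :> inverse (y ^ (k - 1) / sqrt (1 - y ^ (2 * k - 2)))"
  proof (rule DERIV_inverse_function[where a = 0 and b = "arch_M k"])
    show "DERIV (arch_scale_inv k) (arch_scale k w) :> y ^ (k - 1) / sqrt (1 - y ^ (2 * k - 2))"
      using arch_scale_inv_DERIV[OF k y(1,2)] by (simp only: y_def)
    show "y ^ (k - 1) / sqrt (1 - y ^ (2 * k - 2)) \<noteq> 0"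
      using arch_integrand_pos(2)[OF k y(1,2)] by (rule less_imp_neq[THEN not_sym])
  qed (use w arch_scale_bounds(3)[OF k] \<open>isCont (arch_scale k) w\<close> in auto)
  then show ?thesis by (simp add: y_def)
qed

section \<open>Unit volume density and the eikonal equation\<close>

lemma GDERIV_unique:
  assumes "GDERIV f x :> a" "GDERIV f x :> b"
  shows "a = b"
proof -
  have "(\<lambda>h. h \<bullet> a) = (\<lambda>h. h \<bullet> b)"
    using assms unfolding gderiv_def by (rule has_derivative_unique)
  then have "(a - b) \<bullet> a = (a - b) \<bullet> b" by metis
  then have "(a - b) \<bullet> (a - b) = 0" by (simp add: inner_diff_right)
  then show ?thesis by simp
qed

text \<open>Both conditions say that \<open>(y\<^sup>k\<^sup>-\<^sup>1 * s)\<^sup>2 = 1 - y\<^sup>2\<^sup>k\<^sup>-\<^sup>2\<close>, which forces \<open>y \<le> 1\<close> because a square is not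
negative.\<close>

lemma density_eq_1_iff:
  fixes y s :: real
  assumes k: "2 \<le> k" and y: "0 < y" and s: "0 \<le> s"
  shows "y ^ (k - 1) * sqrt (1 + s\<^sup>2) = 1 \<longleftrightarrow> y \<le> 1 \<and> s = sqrt (1 - y ^ (2 * k - 2)) / y ^ (k - 1)"
proof -
  have yk: "0 < y ^ (k - 1)" using y by simp
  have pw: "y ^ (2 * k - 2) = (y ^ (k - 1))\<^sup>2" by (simp add: power_mult[symmetric] diff_mult_distrib2 mult.commute)
  have "y ^ (k - 1) * sqrt (1 + s\<^sup>2) = 1 \<longleftrightarrow> (y ^ (k - 1) * sqrt (1 + s\<^sup>2))\<^sup>2 = 1\<^sup>2"
    using yk by (subst power2_eq_iff_nonneg) auto
  also have "\<dots> \<longleftrightarrow> (y ^ (k - 1) * s)\<^sup>2 = 1 - y ^ (2 * k - 2)"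
    unfolding pw by (auto simp: power_mult_distrib algebra_simps)
  also have "\<dots> \<longleftrightarrow> y \<le> 1 \<and> y ^ (k - 1) * s = sqrt (1 - y ^ (2 * k - 2))"
  proof (cases "y \<le> 1")
    case True
    then have "y ^ (2 * k - 2) \<le> 1" using y by (intro power_le_one) auto
    then show ?thesis
      using True yk s by (auto simp: real_sqrt_unique real_sqrt_pow2 intro!: real_sqrt_unique[symmetric])
  next
    case False
    then have "1 < y ^ (2 * k - 2)" using k by (intro one_less_power) auto
    then have "(y ^ (k - 1) * s)\<^sup>2 \<noteq> 1 - y ^ (2 * k - 2)"
      using zero_le_power2[of "y ^ (k - 1) * s"] by linarith
    then show ?thesis using False by simp
  qed
  also have "\<dots> \<longleftrightarrow> y \<le> 1 \<and> s = sqrt (1 - y ^ (2 * k - 2)) / y ^ (k - 1)"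
    using yk by (simp only: nonzero_eq_divide_eq[OF less_imp_neq[OF yk, THEN not_sym]] mult.commute)
  finally show ?thesis .
qed

text \<open>The function \<open>\<omega> = f\<^sub>k\<^sup>-\<^sup>1 \<circ> f\<close> works, by the chain rule. On the set \<open>A\<close> the values of \<open>f\<close> avoid 1, where
the derivative of \<open>f\<^sub>k\<^sup>-\<^sup>1\<close> is infinite.\<close>

lemma eikonal_of_density_1:
  fixes f :: "'a::real_inner \<Rightarrow> real"
  assumes k: "2 \<le> k" and cont: "continuous_on A g" and der: "\<And>x. x \<in> A \<Longrightarrow> GDERIV f x :> g x"
    and A: "\<And>x. x \<in> A \<Longrightarrow> 0 < f x \<and> f x < 1"
    and J: "\<And>x. x \<in> A \<Longrightarrow> f x ^ (k - 1) * sqrt (1 + (norm (g x))\<^sup>2) = 1"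
  shows "\<exists>\<omega>. (\<forall>x\<in>A. 0 < \<omega> x \<and> \<omega> x \<le> arch_M k) \<and> C1_on A \<omega> \<and> eikonal_on A \<omega> \<and> (\<forall>x\<in>A. f x = arch_scale k (\<omega> x))"
proof (intro exI conjI ballI)
  let ?\<omega> = "\<lambda>x. arch_scale_inv k (f x)"
  let ?G = "\<lambda>x. (f x ^ (k - 1) / sqrt (1 - f x ^ (2 * k - 2))) *\<^sub>R g x"
  have G: "GDERIV ?\<omega> x :> ?G x" if "x \<in> A" for x
    using der[OF that] A[OF that] by (intro GDERIV_DERIV_compose arch_scale_inv_DERIV[OF k]) auto
  have pos: "0 < sqrt (1 - f x ^ (2 * k - 2))" if "x \<in> A" for x
    using A[OF that] by (intro arch_integrand_pos(1)[OF k]) auto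
  have fcont: "continuous_on A f"
    using der unfolding gderiv_def by (meson continuous_at_imp_continuous_on has_derivative_continuous)
  have "continuous_on A ?G"
    using pos by (intro continuous_intros cont fcont) force
  with G show "C1_on A ?\<omega>" unfolding C1_on_def by blast
  show "eikonal_on A ?\<omega>"
    unfolding eikonal_on_def
  proof
    fix x assume x: "x \<in> A"
    have "norm (g x) = sqrt (1 - f x ^ (2 * k - 2)) / f x ^ (k - 1)"
      using J[OF x] density_eq_1_iff[OF k, of "f x" "norm (g x)"] A[OF x] by simp
    then have "norm (?G x) = 1" using A[OF x] pos[OF x] by simp
    with G[OF x] show "\<exists>g. (GDERIV ?\<omega> x :> g) \<and> norm g = 1" by blast
  qed
  fix x assume x: "x \<in> A"
  show "0 < ?\<omega> x" using arch_scale_inv_less[OF k, of 0 "f x"] A[OF x] by simp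
  show "?\<omega> x \<le> arch_M k" using arch_scale_inv_less[OF k, of "f x" 1] A[OF x] by (simp add: arch_scale_inv_1)
  show "f x = arch_scale k (?\<omega> x)" using arch_scale_arch_scale_inv[OF k, of "f x"] A[OF x] by simp
qed

text \<open>At a point where \<open>\<omega>\<close> takes the value \<open>M\<close> it would have a maximum, so its gradient would vanish.\<close>

lemma eikonal_less_bound:
  fixes \<omega> :: "'a::euclidean_space \<Rightarrow> real"
  assumes "open \<Omega>" "eikonal_on \<Omega> \<omega>" "x \<in> \<Omega>" and le: "\<And>y. y \<in> \<Omega> \<Longrightarrow> \<omega> y \<le> M"
  shows "\<omega> x < M"
proof (rule ccontr)
  assume "\<not> \<omega> x < M"
  then have max: "\<forall>y\<in>\<Omega>. \<omega> y \<le> \<omega> x" using le assms(3) by force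
  obtain g where g: "GDERIV \<omega> x :> g" "norm g = 1" using assms(2,3) unfolding eikonal_on_def by blast
  have "(\<lambda>h. h \<bullet> g) = (\<lambda>v. 0)"
    using differential_zero_maxmin[OF assms(3,1) g(1)[unfolded gderiv_def]] max by blast
  then have "g \<bullet> g = 0" by metis
  then show False using g(2) by simp
qed

lemma density_1_of_eikonal:
  fixes \<omega> :: "'a::euclidean_space \<Rightarrow> real"
  assumes k: "2 \<le> k" and C1: "C1_on \<Omega> \<omega>" and eik: "eikonal_on \<Omega> \<omega>"
    and bounds: "\<And>x. x \<in> \<Omega> \<Longrightarrow> 0 < \<omega> x \<and> \<omega> x < arch_M k"
    and f_def: "f = arch_scale k \<circ> \<omega>"
  obtains g where "continuous_on \<Omega> g" "\<And>x. x \<in> \<Omega> \<Longrightarrow> GDERIV f x :> g x" "\<And>x. x \<in> \<Omega> \<Longrightarrow> 0 < f x"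
    "\<And>x. x \<in> \<Omega> \<Longrightarrow> f x ^ (k - 1) * sqrt (1 + (norm (g x))\<^sup>2) = 1"
proof -
  obtain h where h: "continuous_on \<Omega> h" "\<And>x. x \<in> \<Omega> \<Longrightarrow> GDERIV \<omega> x :> h x"
    using C1 unfolding C1_on_def by blast
  have h1: "norm (h x) = 1" if "x \<in> \<Omega>" for x
    using eik that h(2)[OF that] GDERIV_unique unfolding eikonal_on_def by metis
  let ?G = "\<lambda>x. (sqrt (1 - f x ^ (2 * k - 2)) / f x ^ (k - 1)) *\<^sub>R h x"
  have f: "0 < f x" "f x < 1" if "x \<in> \<Omega>" for x
    using arch_scale_bounds[OF k] bounds[OF that] by (auto simp: f_def)
  have G: "GDERIV f x :> ?G x" if "x \<in> \<Omega>" for x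
    using arch_scale_DERIV[OF k] bounds[OF that] h(2)[OF that] unfolding f_def comp_def
    by (intro GDERIV_DERIV_compose) auto
  have fcont: "continuous_on \<Omega> f"
    using G unfolding gderiv_def by (meson continuous_at_imp_continuous_on has_derivative_continuous)
  show thesis
  proof (rule that[of ?G])
    show "continuous_on \<Omega> ?G" using f by (intro continuous_intros fcont h(1)) force
    fix x assume x: "x \<in> \<Omega>"
    show "GDERIV f x :> ?G x" by (rule G[OF x])
    show "0 < f x" by (rule f(1)[OF x])
    have "f x ^ (2 * k - 2) \<le> 1" using f[OF x] by (intro power_le_one) auto
    then have "norm (?G x) = sqrt (1 - f x ^ (2 * k - 2)) / f x ^ (k - 1)"
      using f[OF x] h1[OF x] by simp
    then show "f x ^ (k - 1) * sqrt (1 + (norm (?G x))\<^sup>2) = 1"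
      by (intro density_eq_1_iff[OF k f(1)[OF x] norm_ge_zero, THEN iffD2]) (use f(2)[OF x] in simp)
  qed
qed

section \<open>Spherical arrays with the projection property\<close>

text \<open>The charts of the unit sphere of \<open>real ^ 'k\<close> take values in a Euclidean space of one dimension less,
which needs an index type with one element less. It is obtained from \<open>'k\<close> by leaving out one
arbitrary element; the second alternative only keeps the type nonempty if \<open>'k\<close> has a single
element.\<close>

typedef 'k fewer = "{x :: 'k. x \<noteq> (SOME x. True) \<or> (\<forall>y. y = x)}"
proof (cases "\<forall>y :: 'k. y = (SOME x. True)")
  case True
  then show ?thesis by (intro exI[of _ "SOME x. True"]) simp
next
  case False
  then show ?thesis by blast
qed

lemma card_fewer_set:
  assumes "2 \<le> CARD('k::finite)"
  shows "card {x :: 'k. x \<noteq> (SOME x. True) \<or> (\<forall>y. y = x)} = CARD('k) - 1"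
proof -
  have "\<not> (\<forall>y :: 'k. y = x)" for x
  proof
    assume "\<forall>y. y = x"
    then have "(UNIV :: 'k set) = {x}" by blast
    then have "CARD('k) = card {x}" by (rule arg_cong)
    with assms show False by simp
  qed
  then have "{x :: 'k. x \<noteq> (SOME x. True) \<or> (\<forall>y. y = x)} = UNIV - {SOME x. True}" by auto
  then show ?thesis by (simp add: card_Diff_singleton)
qed

instance fewer :: (finite) finite
proof
  have "finite (range (Rep_fewer :: 'a fewer \<Rightarrow> 'a))" by (rule finite)
  then show "finite (UNIV :: 'a fewer set)"
    by (rule finite_imageD) (simp add: inj_on_def Rep_fewer_inject)
qed

lemma card_fewer:
  assumes "2 \<le> CARD('k::finite)"
  shows "CARD('k fewer) = CARD('k) - 1"
  by (rule trans[OF type_definition.card[OF type_definition_fewer] card_fewer_set[OF assms]])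

theorem theorem2p1:
  fixes n k :: nat and \<Omega> :: "(real ^ 'm) set"
  assumes "2 \<le> k" and "k \<le> n - 1"
    and "CARD('m) = n - k" and "CARD('k) = k"
    and "open \<Omega>" and "connected \<Omega>" and "\<Omega> \<noteq> {}"
  shows
    "(\<forall>f :: real ^ 'm \<Rightarrow> real.
        (\<forall>x\<in>\<Omega>. 0 \<le> f x) \<and> C1_on \<Omega> f \<and>
        archimedean_projection (vol (k - 1) (sphere (0 :: real ^ 'k) 1))
          (spherical_array \<Omega> f :: ((real ^ 'm) \<times> (real ^ 'k)) set)
        \<longrightarrow> (\<forall>x\<in>\<Omega>. f x \<le> 1) \<and>
          (let A = {x \<in> \<Omega>. 0 < f x \<and> f x < 1} in
            \<exists>\<omega> :: real ^ 'm \<Rightarrow> real.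
              (\<forall>x\<in>A. 0 < \<omega> x \<and> \<omega> x \<le> arch_M k) \<and> C1_on A \<omega> \<and> eikonal_on A \<omega> \<and>
              (\<forall>x\<in>A. f x = arch_scale k (\<omega> x))))
     \<and>
     (\<forall>\<omega> :: real ^ 'm \<Rightarrow> real.
        (\<forall>x\<in>\<Omega>. 0 < \<omega> x) \<and> C1_on \<Omega> \<omega> \<and> eikonal_on \<Omega> \<omega> \<and> (\<forall>x\<in>\<Omega>. \<omega> x \<le> arch_M k)
        \<longrightarrow> (let B = {x \<in> \<Omega>. 0 < \<omega> x \<and> \<omega> x \<le> arch_M k}; f = arch_scale k \<circ> \<omega> in
          C1_on B f \<and>
          archimedean_projection (vol (k - 1) (sphere (0 :: real ^ 'k) 1))
            (spherical_array B f :: ((real ^ 'm) \<times> (real ^ 'k)) set)))"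
proof -
  have km: "DIM(real ^ 'k fewer) + 1 = DIM(real ^ 'k)" "DIM(real ^ 'k fewer) = k - 1"
  proof -
    have "2 \<le> CARD('k)" unfolding assms(4) by (rule assms(1))
    then have "CARD('k fewer) = k - 1" unfolding assms(4)[symmetric] by (rule card_fewer)
    then show "DIM(real ^ 'k fewer) + 1 = DIM(real ^ 'k)" "DIM(real ^ 'k fewer) = k - 1"
      using assms(1,4) by simp_all
  qed
  have dims: "DIM((real ^ 'm) \<times> (real ^ 'k)) - 1 = DIM((real ^ 'm) \<times> (real ^ 'k fewer))"
    using km by simp
  let ?C = "vol (k - 1) (sphere (0 :: real ^ 'k) 1)"
  have C: "0 < ?C" "?C < \<infinity>"
    using vol_sphere_pos[OF km(1)] vol_sphere_finite[OF km(1)] unfolding km(2) by simp_all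
  have part_a: "(\<forall>x\<in>\<Omega>. f x \<le> 1) \<and> (let A = {x \<in> \<Omega>. 0 < f x \<and> f x < 1} in
            \<exists>\<omega> :: real ^ 'm \<Rightarrow> real.
              (\<forall>x\<in>A. 0 < \<omega> x \<and> \<omega> x \<le> arch_M k) \<and> C1_on A \<omega> \<and> eikonal_on A \<omega> \<and>
              (\<forall>x\<in>A. f x = arch_scale k (\<omega> x)))"
    if nonneg: "\<forall>x\<in>\<Omega>. 0 \<le> f x" and C1: "C1_on \<Omega> f"
      and app: "archimedean_projection ?C (spherical_array \<Omega> f :: ((real ^ 'm) \<times> (real ^ 'k)) set)"
    for f :: "real ^ 'm \<Rightarrow> real"
  proof -
    obtain g where g: "continuous_on \<Omega> g" "\<And>x. x \<in> \<Omega> \<Longrightarrow> GDERIV f x :> g x"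
      using C1 unfolding C1_on_def by blast
    have vols: "vol DIM((real ^ 'm) \<times> (real ^ 'k fewer)) (spherical_array E f :: ((real ^ 'm) \<times> (real ^ 'k)) set)
        = vol DIM(real ^ 'k fewer) (sphere (0 :: real ^ 'k) 1) * emeasure lborel E"
      if E: "E \<in> sets borel" "E \<subseteq> \<Omega>" for E
    proof -
      have "E \<in> sets lebesgue" using E(1) by simp
      then have "vol (DIM((real ^ 'm) \<times> (real ^ 'k)) - 1)
          (spherical_array \<Omega> f \<inter> fst -` E :: ((real ^ 'm) \<times> (real ^ 'k)) set) = ?C * emeasure lebesgue E"
        using app E(2) unfolding archimedean_projection_def fst_spherical_array by blast
      then show ?thesis
        unfolding dims km(2) spherical_array_over[OF E(2)] using E(1) by simp
    qed
    have J: "f x ^ (k - 1) * sqrt (1 + (norm (g x))\<^sup>2) = 1" if "x \<in> \<Omega>" "0 < f x" for x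
      using volume_density_eq_1[OF km(1) assms(5) that(1) g that(2) vols] unfolding km(2) by blast
    have "f x \<le> 1" if "x \<in> \<Omega>" for x
    proof (cases "0 < f x")
      case True
      then show ?thesis
        using J[OF that True] density_eq_1_iff[OF assms(1) True, of "norm (g x)"] by simp
    qed simp
    moreover have "\<exists>\<omega>. (\<forall>x\<in>{x \<in> \<Omega>. 0 < f x \<and> f x < 1}. 0 < \<omega> x \<and> \<omega> x \<le> arch_M k) \<and>
        C1_on {x \<in> \<Omega>. 0 < f x \<and> f x < 1} \<omega> \<and> eikonal_on {x \<in> \<Omega>. 0 < f x \<and> f x < 1} \<omega> \<and>
        (\<forall>x\<in>{x \<in> \<Omega>. 0 < f x \<and> f x < 1}. f x = arch_scale k (\<omega> x))"
      by (rule eikonal_of_density_1[OF assms(1), where g = g])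
        (use J g in \<open>auto intro: continuous_on_subset\<close>)
    ultimately show ?thesis unfolding Let_def by blast
  qed
  have part_b: "let B = {x \<in> \<Omega>. 0 < \<omega> x \<and> \<omega> x \<le> arch_M k}; f = arch_scale k \<circ> \<omega> in
          C1_on B f \<and> archimedean_projection ?C (spherical_array B f :: ((real ^ 'm) \<times> (real ^ 'k)) set)"
    if pos: "\<forall>x\<in>\<Omega>. 0 < \<omega> x" and C1: "C1_on \<Omega> \<omega>" and eik: "eikonal_on \<Omega> \<omega>"
      and le: "\<forall>x\<in>\<Omega>. \<omega> x \<le> arch_M k" for \<omega> :: "real ^ 'm \<Rightarrow> real"
  proof -
    define f where "f = arch_scale k \<circ> \<omega>"
    have B: "{x \<in> \<Omega>. 0 < \<omega> x \<and> \<omega> x \<le> arch_M k} = \<Omega>" using pos le by blast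
    have bounds: "0 < \<omega> x \<and> \<omega> x < arch_M k" if "x \<in> \<Omega>" for x
      using pos that eikonal_less_bound[OF assms(5) eik that] le by blast
    obtain g where g: "continuous_on \<Omega> g" "\<And>x. x \<in> \<Omega> \<Longrightarrow> GDERIV f x :> g x"
      and fpos: "\<And>x. x \<in> \<Omega> \<Longrightarrow> 0 < f x"
      and J: "\<And>x. x \<in> \<Omega> \<Longrightarrow> f x ^ (k - 1) * sqrt (1 + (norm (g x))\<^sup>2) = 1"
      by (rule density_1_of_eikonal[OF assms(1) C1 eik bounds f_def]) (assumption, rule that, simp_all)
    have "C1_on \<Omega> f" unfolding C1_on_def using g by blast
    moreover have "archimedean_projection ?C (spherical_array \<Omega> f :: ((real ^ 'm) \<times> (real ^ 'k)) set)"
      unfolding archimedean_projection_def fst_spherical_array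
    proof (intro conjI ballI impI C)
      fix U :: "(real ^ 'm) set" assume U: "U \<in> sets lebesgue" "U \<subseteq> \<Omega>"
      show "vol (DIM((real ^ 'm) \<times> (real ^ 'k)) - 1) (spherical_array \<Omega> f \<inter> fst -` U :: ((real ^ 'm) \<times> (real ^ 'k)) set)
          = ?C * emeasure lebesgue U"
        unfolding dims spherical_array_over[OF U(2)]
        using vol_array_of_density_1[OF km(1) assms(5) g fpos _ U] J unfolding km(2) by blast
    qed
    ultimately show ?thesis unfolding Let_def B f_def[symmetric] by blast
  qed
  show ?thesis using part_a part_b by blast
qed

end
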